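(* Let $\Delta t>0$ and let $\mathbf m_h^n\in\mathbf S_h^1$ satisfy $|\mathbf m_h^n(\mathbf z)|=1$ for all $\mathbf z\in\mathcal Q$. For $\widetilde{\mathbf m}_h^{n+1}\in\mathbf S_h^1$, the relation $$\Big(\tfrac{\widetilde{\mathbf m}_h^{n+1}-\mathbf m_h^n}{\Delta t},\mathbf v_h\Big)_h=-\big(\mathbf m_h^n\times(\mathbf m_h^n\times\widetilde\Delta_h\widetilde{\mathbf m}_h^{n+1}),\mathbf v_h\big)_h\qquad\forall\,\mathbf v_h\in\mathbf S_h^1$$ is equivalent to $$\Big(\tfrac{\widetilde{\mathbf m}_h^{n+1}-\mathbf m_h^n}{\Delta t},\mathbf v_h\Big)_h+(\nabla\widetilde{\mathbf m}_h^{n+1},\nabla\mathbf v_h)_h=\big(|\nabla\mathbf m_h^n|^2,\mathbf m_h^n\cdot\mathbf v_h\big)_h+\big(\nabla(\widetilde{\mathbf m}_h^{n+1}-\mathbf m_h^n),\nabla I_h(\mathbf m_h^n(\mathbf m_h^n\cdot\mathbf v_h))\big)_h\qquad\forall\,\mathbf v_h\in\mathbf S_h^1 .$$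
   Context: Mesh and space: $d\in\{1,2,3\}$; $\Omega\subset\mathbb R^d$ is a bounded rectangular domain (product of intervals). $\mathscr T_h$ is a mesh of $\Omega$ into Cartesian boxes generated by the tensor product of one-dimensional partitions in each coordinate direction (from a shape-regular, quasi-uniform family). $Q_1(K)$ is the space of polynomials on $K$ of degree at most $1$ in each variable, and $\mathbf S_h^1=\{\mathbf v_h\in H^1(\Omega)^3:\mathbf v_h|_K\in Q_1(K)^3\ \forall K\in\mathscr T_h\}$. $\mathcal Q_K$ is the set of vertices of $K$, $\mathcal Q$ the set of all mesh vertices (finite element nodes), $I_h$ the nodal $Q_1$ interpolation operator at $\mathcal Q$ (applied componentwise). Quadrature: the tensor-product two-point Gauss--Lobatto rule, with weights $\omega_{K,\mathbf z}=2^{-d}|K|$, $\mathbf z\in\mathcal Q_K$. For elementwise smooth (scalar-, vector- or matrix-valued) functions, $(f,g)_h=\sum_K\sum_{\mathbf z\in\mathcal Q_K}\omega_{K,\mathbf z}\,(f|_K)(\mathbf z)\cdot(g|_K)(\mathbf z)$, with Frobenius product for matrices; all gradients are taken elementwise, and $|\nabla\mathbf m_h^n|$ is the Frobenius norm. The discrete Laplacian $\widetilde\Delta_h:\mathbf S_h^1\to\mathbf S_h^1$ is defined by $(\widetilde\Delta_h\mathbf v_h,\mathbf w_h)_h=-(\nabla\mathbf v_h,\nabla\mathbf w_h)_h$ for all $\mathbf w_h\in\mathbf S_h^1$. *)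

theory Defs
  imports "HOL-Analysis.Analysis"
begin

definition partial_deriv :: "'d::finite \<Rightarrow> (real^'d \<Rightarrow> real) \<Rightarrow> real^'d \<Rightarrow> real" where
  "partial_deriv i f x = frechet_derivative f (at x) (axis i 1)"

(* All iterated partial derivatives exist and are (Frechet) differentiable everywhere; since
   differentiability entails continuity, this is C^infinity. *)
definition smooth :: "(real^'d::finite \<Rightarrow> real) \<Rightarrow> bool" where
  "smooth f \<longleftrightarrow> (\<forall>is. foldr partial_deriv is f differentiable_on UNIV)"

definition test_functions :: "(real^'d::finite) set \<Rightarrow> (real^'d \<Rightarrow> real) set" where
  "test_functions \<Omega> =
     {\<phi>. smooth \<phi> \<and> compact (closure {x. \<phi> x \<noteq> 0}) \<and> closure {x. \<phi> x \<noteq> 0} \<subseteq> \<Omega>}"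

definition L2_space :: "(real^'d::finite) set \<Rightarrow> (real^'d \<Rightarrow> real) set" where
  "L2_space \<Omega> = {f. f \<in> borel_measurable (lebesgue_on \<Omega>) \<and>
                     integrable (lebesgue_on \<Omega>) (\<lambda>x. (f x)\<^sup>2)}"

definition weak_partial_deriv ::
    "(real^'d::finite) set \<Rightarrow> 'd \<Rightarrow> (real^'d \<Rightarrow> real) \<Rightarrow> (real^'d \<Rightarrow> real) \<Rightarrow> bool" where
  "weak_partial_deriv \<Omega> i f g \<longleftrightarrow>
     (\<forall>\<phi>\<in>test_functions \<Omega>.
        (LINT x|lebesgue_on \<Omega>. f x * partial_deriv i \<phi> x) = - (LINT x|lebesgue_on \<Omega>. g x * \<phi> x))"

definition H1_space :: "(real^'d::finite) set \<Rightarrow> (real^'d \<Rightarrow> real) set" where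
  "H1_space \<Omega> =
     {f \<in> L2_space \<Omega>. \<forall>i. \<exists>g\<in>L2_space \<Omega>. weak_partial_deriv \<Omega> i f g}"

definition is_partition :: "real \<Rightarrow> real \<Rightarrow> nat \<Rightarrow> (nat \<Rightarrow> real) \<Rightarrow> bool" where
  "is_partition \<alpha> \<beta> n t \<longleftrightarrow> t 0 = \<alpha> \<and> t n = \<beta> \<and> (\<forall>j<n. t j < t (Suc j))"

(* The elements are the closed boxes K. *)
definition tensor_mesh :: "real^'d::finite \<Rightarrow> real^'d \<Rightarrow> (real^'d) set set \<Rightarrow> bool" where
  "tensor_mesh a b \<T> \<longleftrightarrow>
     (\<exists>N t. (\<forall>i. is_partition (a $ i) (b $ i) (N i) (t i)) \<and>
        \<T> = {cbox (\<chi> i. t i (k i)) (\<chi> i. t i (Suc (k i))) | k. \<forall>i. k i < N i})"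

definition shape_regular :: "(real^'d::finite) set set set \<Rightarrow> bool" where
  "shape_regular F \<longleftrightarrow>
     (\<exists>\<sigma>>0. \<forall>\<T>\<in>F. \<forall>K\<in>\<T>. \<exists>x r. r > 0 \<and> cball x r \<subseteq> K \<and> diameter K \<le> \<sigma> * r)"

definition quasi_uniform :: "(real^'d::finite) set set set \<Rightarrow> bool" where
  "quasi_uniform F \<longleftrightarrow>
     (\<exists>\<gamma>>0. \<forall>\<T>\<in>F. \<forall>K\<in>\<T>. \<forall>K'\<in>\<T>. diameter K \<le> \<gamma> * diameter K')"

definition vertices :: "(real^'d::finite) set \<Rightarrow> (real^'d) set" where
  "vertices K = {z. \<forall>i. z $ i \<in> {interval_lowerbound K $ i, interval_upperbound K $ i}}"

definition nodes :: "(real^'d::finite) set set \<Rightarrow> (real^'d) set" where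
  "nodes \<T> = (\<Union>K\<in>\<T>. vertices K)"

(* A monomial of degree at most 1 in each variable is the product of the coordinates in some
   set A of indices. *)
definition Q1_on :: "(real^'d::finite) set \<Rightarrow> (real^'d \<Rightarrow> real) set" where
  "Q1_on K = {p. \<exists>c. \<forall>x\<in>K. p x = (\<Sum>A\<in>Pow UNIV. c A * (\<Prod>i\<in>A. x $ i))}"

(* Elements of H^1 that are elementwise Q1 are represented by their pointwise representative on
   the closure of \<Omega> (each restriction to a closed element is polynomial), extended by 0, so that
   equality of functions on real^'d is equality in the finite element space. *)
definition FE_scalar :: "(real^'d::finite) set \<Rightarrow> (real^'d) set set \<Rightarrow> (real^'d \<Rightarrow> real) set" where
  "FE_scalar \<Omega> \<T> =
     {v \<in> H1_space \<Omega>. (\<forall>K\<in>\<T>. v \<in> Q1_on K) \<and> (\<forall>x. x \<notin> closure \<Omega> \<longrightarrow> v x = 0)}"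

definition FE_space :: "(real^'d::finite) set \<Rightarrow> (real^'d) set set \<Rightarrow> (real^'d \<Rightarrow> real^3) set" where
  "FE_space \<Omega> \<T> = {v. \<forall>j. (\<lambda>x. v x $ j) \<in> FE_scalar \<Omega> \<T>}"

definition interp_scalar ::
    "(real^'d::finite) set \<Rightarrow> (real^'d) set set \<Rightarrow> (real^'d \<Rightarrow> real) \<Rightarrow> real^'d \<Rightarrow> real" where
  "interp_scalar \<Omega> \<T> f = (THE p. p \<in> FE_scalar \<Omega> \<T> \<and> (\<forall>z\<in>nodes \<T>. p z = f z))"

definition interp ::
    "(real^'d::finite) set \<Rightarrow> (real^'d) set set \<Rightarrow> (real^'d \<Rightarrow> real^3) \<Rightarrow> real^'d \<Rightarrow> real^3" where
  "interp \<Omega> \<T> f = (\<lambda>x. \<chi> j. interp_scalar \<Omega> \<T> (\<lambda>y. f y $ j) x)"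

(* An elementwise function f is given by its branches f K on the elements K; a globally defined
   function v is the constant family \<lambda>_. v. On matrices the inner product is Frobenius'. *)
definition quad_inner ::
    "(real^'d::finite) set set \<Rightarrow> ((real^'d) set \<Rightarrow> real^'d \<Rightarrow> 'b::real_inner) \<Rightarrow>
     ((real^'d) set \<Rightarrow> real^'d \<Rightarrow> 'b) \<Rightarrow> real" where
  "quad_inner \<T> f g =
     (\<Sum>K\<in>\<T>. \<Sum>z\<in>vertices K. measure lborel K / 2 ^ CARD('d) * (f K z \<bullet> g K z))"

(* The derivative within the closed box K, which is unique also at boundary points of K. *)
definition grad :: "(real^'d::finite \<Rightarrow> real^3) \<Rightarrow> (real^'d) set \<Rightarrow> real^'d \<Rightarrow> real^'d^3" where
  "grad v K x = jacobian v (at x within K)"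

definition discrete_laplacian ::
    "(real^'d::finite) set \<Rightarrow> (real^'d) set set \<Rightarrow> (real^'d \<Rightarrow> real^3) \<Rightarrow> real^'d \<Rightarrow> real^3" where
  "discrete_laplacian \<Omega> \<T> v =
     (THE u. u \<in> FE_space \<Omega> \<T> \<and>
        (\<forall>w\<in>FE_space \<Omega> \<T>. quad_inner \<T> (\<lambda>_. u) (\<lambda>_. w) = - quad_inner \<T> (grad v) (grad w)))"

end

theory Submission
  imports Defs
begin

text \<open>At a vertex of an element, every entry of the gradient of an elementwise \<open>Q\<^sub>1\<close> function is a
  difference quotient along an edge. The involution swapping the two ends of an edge therefore gives
  an exact summation by parts for \<open>(\<nabla>v, \<nabla>w)\<^sub>h\<close>, and hence an explicit discrete Laplacian. Since the
  quadrature only sees nodal values, \<open>m \<times> (m \<times> u) = (m \<bullet> u) m - u\<close> at the nodes turns the first relation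
  into the second one up to the identity \<open>(\<nabla>m, \<nabla>I\<^sub>h(s m))\<^sub>h = (\<bar>\<nabla>m\<bar>\<^sup>2, s)\<^sub>h\<close>, which holds edge by edge
  because \<open>\<bar>m(z') - m(z)\<bar>\<^sup>2 = 2 - 2 m(z') \<bullet> m(z)\<close>. The functional-analytic content is that continuous
  piecewise \<open>Q\<^sub>1\<close> functions lie in \<open>H\<^sup>1\<close>, so that \<open>I\<^sub>h\<close> and the discrete Laplacian are well defined.\<close>

section \<open>Multilinear polynomials\<close>

lemma Q1_on_add: "p \<in> Q1_on K \<Longrightarrow> q \<in> Q1_on K \<Longrightarrow> (\<lambda>x. p x + q x) \<in> Q1_on K"
proof -
  assume "p \<in> Q1_on K" "q \<in> Q1_on K"
  then obtain c d where cd: "\<forall>x\<in>K. p x = (\<Sum>A\<in>Pow UNIV. c A * (\<Prod>i\<in>A. x $ i))"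
    "\<forall>x\<in>K. q x = (\<Sum>A\<in>Pow UNIV. d A * (\<Prod>i\<in>A. x $ i))"
    by (auto simp: Q1_on_def)
  then show ?thesis
    by (auto simp: Q1_on_def sum.distrib distrib_right intro!: exI[of _ "\<lambda>A. c A + d A"])
qed

lemma Q1_on_cmult: "p \<in> Q1_on K \<Longrightarrow> (\<lambda>x. s * p x) \<in> Q1_on K"
proof -
  assume "p \<in> Q1_on K"
  then obtain c where "\<forall>x\<in>K. p x = (\<Sum>A\<in>Pow UNIV. c A * (\<Prod>i\<in>A. x $ i))"
    by (auto simp: Q1_on_def)
  then show ?thesis
    by (auto simp: Q1_on_def sum_distrib_left mult.assoc intro!: exI[of _ "\<lambda>A. s * c A"])
qed

lemma Q1_on_zero: "(\<lambda>x. 0) \<in> Q1_on K"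
  by (auto simp: Q1_on_def intro!: exI[of _ "\<lambda>_. 0"])

lemma Q1_on_sum: "(\<And>z. z \<in> S \<Longrightarrow> p z \<in> Q1_on K) \<Longrightarrow> (\<lambda>x. \<Sum>z\<in>S. p z x) \<in> Q1_on K"
  by (induction S rule: infinite_finite_induct) (auto intro: Q1_on_add Q1_on_zero)

lemma Q1_on_cong: "p \<in> Q1_on K \<Longrightarrow> (\<And>x. x \<in> K \<Longrightarrow> q x = p x) \<Longrightarrow> q \<in> Q1_on K"
  by (auto simp: Q1_on_def)

text \<open>Multiplying out, each set \<open>A\<close> of indices collects the linear terms from
  \<open>A\<close> and the constants from its complement. This serves the tensor products of hat
  functions.\<close>

lemma Q1_on_prod_affine: "(\<lambda>x. \<Prod>i\<in>UNIV. \<beta> i * x $ i + \<alpha> i) \<in> Q1_on K"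
  unfolding Q1_on_def
  by (auto simp: prod_add prod.distrib mult_ac
      intro!: exI[of _ "\<lambda>A. (\<Prod>i\<in>A. \<beta> i) * (\<Prod>i\<in>UNIV-A. \<alpha> i)"])

text \<open>Degree at most one in each variable means that the polynomial is affine along every
  coordinate line, with one pair of coefficients for the whole line.\<close>

lemma Q1_on_line:
  assumes "p \<in> Q1_on K"
  obtains c d where "\<And>s. x + s *\<^sub>R axis i 1 \<in> K \<Longrightarrow> p (x + s *\<^sub>R axis i 1) = d + s * c"
proof -
  obtain e where e: "\<And>x. x \<in> K \<Longrightarrow> p x = (\<Sum>A\<in>Pow UNIV. e A * (\<Prod>j\<in>A. x $ j))"
    using assms by (auto simp: Q1_on_def)
  \<comment> \<open>The i-th partial derivative of the polynomial, in which the i-th coordinate no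
    longer occurs.\<close>
  define c where "c = (\<Sum>A\<in>Pow UNIV. if i \<in> A then e A * (\<Prod>j\<in>A-{i}. x $ j) else 0)"
  define d where "d = (\<Sum>A\<in>Pow UNIV. e A * (\<Prod>j\<in>A. x $ j))"
  have mono: "e A * (\<Prod>j\<in>A. (x + s *\<^sub>R axis i 1) $ j) =
      e A * (\<Prod>j\<in>A. x $ j) + s * (if i \<in> A then e A * (\<Prod>j\<in>A-{i}. x $ j) else 0)" for A s
  proof (cases "i \<in> A")
    case True
    have "(\<Prod>j\<in>A-{i}. (x + s *\<^sub>R axis i 1) $ j) = (\<Prod>j\<in>A-{i}. x $ j)"
      by (intro prod.cong) (auto simp: axis_def)
    then show ?thesis using True
      by (simp add: prod.remove[of A i] axis_def algebra_simps)
  next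
    case False
    then have "(\<Prod>j\<in>A. (x + s *\<^sub>R axis i 1) $ j) = (\<Prod>j\<in>A. x $ j)"
      by (intro prod.cong) (auto simp: axis_def)
    then show ?thesis using False by simp
  qed
  have "p (x + s *\<^sub>R axis i 1) = d + s * c" if "x + s *\<^sub>R axis i 1 \<in> K" for s
    using e[OF that] unfolding mono c_def d_def by (simp add: sum.distrib sum_distrib_left)
  then show thesis by (rule that)
qed

lemma Q1_on_differentiable:
  assumes "p \<in> Q1_on K" "x \<in> K"
  shows "p differentiable (at x within K)"
proof -
  obtain e where e: "\<And>x. x \<in> K \<Longrightarrow> p x = (\<Sum>A\<in>Pow UNIV. e A * (\<Prod>j\<in>A. x $ j))"
    using assms by (auto simp: Q1_on_def)
  have [simp]: "(\<lambda>x. x $ j) differentiable F" for j :: 'a and F :: "(real^'a) filter"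
    by (intro bounded_linear_imp_differentiable bounded_linear_vec_nth)
  have "(\<lambda>x. \<Prod>j\<in>A. x $ j) differentiable (at x within K)" for A
    by (induction A rule: infinite_finite_induct) (auto intro: differentiable_mult)
  then have "(\<lambda>x. \<Sum>A\<in>Pow UNIV. e A * (\<Prod>j\<in>A. x $ j)) differentiable (at x within K)"
    by (intro differentiable_sum ballI differentiable_mult) auto
  then show ?thesis
    by (rule differentiable_transform_within[OF _ zero_less_one assms(2)]) (simp add: e)
qed

section \<open>Boxes and their vertices\<close>

text \<open>Reflection in the midplane of \<open>K\<close> orthogonal to axis \<open>i\<close>.
  Defined for all points, it is an involution without side conditions; on vertices it swaps the two
  ends of an edge.\<close>

definition opposite :: "(real^'d::finite) set \<Rightarrow> 'd \<Rightarrow> real^'d \<Rightarrow> real^'d" where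
  "opposite K i z =
     (\<chi> j. if j = i then interval_lowerbound K $ i + interval_upperbound K $ i - z $ i else z $ j)"

definition width :: "(real^'d::finite) set \<Rightarrow> 'd \<Rightarrow> real" where
  "width K i = interval_upperbound K $ i - interval_lowerbound K $ i"

definition nondegenerate_box :: "(real^'d::finite) set \<Rightarrow> bool" where
  "nondegenerate_box K \<longleftrightarrow> (\<exists>l u. K = cbox l u \<and> (\<forall>i. l $ i < u $ i))"

lemma interval_bounds_cart:
  fixes l u :: "real^'d::finite"
  assumes "\<forall>i. l $ i \<le> u $ i"
  shows "interval_lowerbound (cbox l u) = l" "interval_upperbound (cbox l u) = u"
  using assms by (auto simp: Basis_vec_def inner_axis)

lemma nondegenerate_boxE:
  assumes "nondegenerate_box K"
  obtains l u where "K = cbox l u" "\<And>i. l $ i < u $ i" "interval_lowerbound K = l"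
    "interval_upperbound K = u" "\<And>i. width K i = u $ i - l $ i"
    "vertices K = {z. \<forall>i. z $ i = l $ i \<or> z $ i = u $ i}"
    "\<And>i z. opposite K i z = (\<chi> j. if j = i then l $ i + u $ i - z $ i else z $ j)"
proof -
  obtain l u where lu: "K = cbox l u" "\<forall>i. l $ i < u $ i"
    using assms by (auto simp: nondegenerate_box_def)
  moreover have "interval_lowerbound K = l" "interval_upperbound K = u"
    using lu by (simp_all add: interval_bounds_cart less_imp_le)
  ultimately show thesis by (intro that[of l u]) (auto simp: width_def opposite_def vertices_def)
qed

lemma vertices_subset:
  assumes "nondegenerate_box K"
  shows "vertices K \<subseteq> K"
proof
  obtain l u where K: "K = cbox l u" "\<And>i. l $ i < u $ i"
    "vertices K = {z. \<forall>i. z $ i = l $ i \<or> z $ i = u $ i}"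
    by (rule nondegenerate_boxE[OF assms], rule that, assumption+)
  fix z assume "z \<in> vertices K"
  then have "l $ i \<le> z $ i \<and> z $ i \<le> u $ i" for i
    using K(2)[of i] by (auto simp: K(3) dest: spec[of _ i])
  then show "z \<in> K" by (simp add: K(1) mem_box_cart)
qed

lemma width_pos: "nondegenerate_box K \<Longrightarrow> width K i > 0"
  by (erule nondegenerate_boxE) simp

lemma measure_pos: "nondegenerate_box K \<Longrightarrow> measure lborel K > 0"
  by (erule nondegenerate_boxE) (auto simp: content_pos_lt_eq Basis_vec_def inner_axis)

lemma finite_vertices: "finite (vertices K)"
proof -
  let ?V = "\<lambda>i. {interval_lowerbound K $ i, interval_upperbound K $ i}"
  have "vertices K \<subseteq> vec_lambda ` (PiE UNIV ?V)"
  proof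
    fix z assume "z \<in> vertices K"
    then have "vec_nth z \<in> PiE UNIV ?V" by (simp add: vertices_def PiE_iff)
    then show "z \<in> vec_lambda ` (PiE UNIV ?V)" by (rule image_eqI[rotated]) (simp add: vec_nth_inverse)
  qed
  then show ?thesis
    by (rule finite_subset) (intro finite_imageI finite_PiE; simp)
qed

lemma opposite_vertices: "z \<in> vertices K \<Longrightarrow> opposite K i z \<in> vertices K"
  unfolding vertices_def mem_Collect_eq
proof
  fix j
  assume "\<forall>j. z $ j \<in> {interval_lowerbound K $ j, interval_upperbound K $ j}"
  from spec[OF this, of j]
  show "opposite K i z $ j \<in> {interval_lowerbound K $ j, interval_upperbound K $ j}"
    by (auto simp: opposite_def)
qed

lemma opposite_opposite [simp]: "opposite K i (opposite K i z) = z"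
  by (simp add: opposite_def vec_eq_iff)

lemma sum_vertices_opposite: "(\<Sum>z\<in>vertices K. f (opposite K i z)) = (\<Sum>z\<in>vertices K. f z)"
  by (rule sum.reindex_bij_witness[of _ "opposite K i" "opposite K i"])
    (auto intro: opposite_vertices)

text \<open>The sign of the difference tells at which end of the edge \<open>z\<close> lies;
  squaring removes it.\<close>

lemma opposite_diff_sq:
  "z \<in> vertices K \<Longrightarrow> (opposite K i z $ i - z $ i)\<^sup>2 = (width K i)\<^sup>2"
  by (auto simp: vertices_def opposite_def width_def power2_commute dest!: spec[of _ i])

lemma opposite_eq: "opposite K i z = z + (opposite K i z $ i - z $ i) *\<^sub>R axis i 1"
  by (simp add: opposite_def vec_eq_iff axis_def)

text \<open>Eliminating the slope in favour of a fraction \<open>r\<close> of a segment leaves a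
  formula in the two end values only, so that functions agreeing at the ends can be
  compared.\<close>

lemma Q1_on_affine:
  assumes p: "p \<in> Q1_on K" and x: "x \<in> K" and y: "x + s *\<^sub>R axis i 1 \<in> K"
    and z: "x + (r * s) *\<^sub>R axis i 1 \<in> K"
  shows "p (x + (r * s) *\<^sub>R axis i 1) = p x + r * (p (x + s *\<^sub>R axis i 1) - p x)"
proof -
  obtain c d where cd: "\<And>s. x + s *\<^sub>R axis i 1 \<in> K \<Longrightarrow> p (x + s *\<^sub>R axis i 1) = d + s * c"
    using Q1_on_line[OF p] by blast
  from cd[of 0] cd[OF y] cd[OF z] x show ?thesis by (simp add: algebra_simps)
qed

lemma Q1_on_eq_vertices:
  assumes K: "nondegenerate_box K" and p: "p \<in> Q1_on K" "q \<in> Q1_on K"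
    and eq: "\<And>z. z \<in> vertices K \<Longrightarrow> p z = q z" and x: "x \<in> K"
  shows "p x = q x"
proof -
  obtain l u where K': "K = cbox l u" "\<And>i. l $ i < u $ i"
    "vertices K = {z. \<forall>i. z $ i = l $ i \<or> z $ i = u $ i}"
    by (rule nondegenerate_boxE[OF K], rule that, assumption+)
  \<comment> \<open>Induction on the set \<open>S\<close> of coordinates that are free: vertices for
    the empty set, then edges, faces, and finally all of \<open>K\<close>.\<close>
  have "\<forall>x\<in>K. (\<forall>i. i \<notin> S \<longrightarrow> x $ i = l $ i \<or> x $ i = u $ i) \<longrightarrow> p x = q x" if "finite S" for S
    using that
  proof induction
    case empty
    then show ?case using eq by (simp add: K'(3))
  next
    case (insert i S)
    show ?case
    proof (intro ballI impI)
      fix x assume x: "x \<in> K" and xS: "\<forall>j. j \<notin> insert i S \<longrightarrow> x $ j = l $ j \<or> x $ j = u $ j"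
      \<comment> \<open>The points \<open>y\<close> and \<open>w\<close> push coordinate
        \<open>i\<close> of \<open>x\<close> to the two ends; the induction hypothesis covers both,
        and \<open>x\<close> lies between them.\<close>
      define y where "y = x + (l $ i - x $ i) *\<^sub>R axis i 1"
      define w where "w = y + (u $ i - l $ i) *\<^sub>R axis i 1"
      have [simp]: "y $ j = (if j = i then l $ i else x $ j)"
        "w $ j = (if j = i then u $ i else x $ j)" for j
        by (auto simp: y_def w_def axis_def)
      have yw: "y \<in> K" "w \<in> K" using x less_imp_le[OF K'(2)] by (auto simp: K' mem_box_cart)
      have *: "p y = q y" "p w = q w"
        using insert.IH xS yw by auto
      define r where "r = (x $ i - l $ i) / (u $ i - l $ i)"
      have r: "r * (u $ i - l $ i) = x $ i - l $ i" using K'(2)[of i] by (simp add: r_def)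
      have xr: "x = y + (r * (u $ i - l $ i)) *\<^sub>R axis i 1" unfolding r y_def
        by (simp add: vec_eq_iff axis_def)
      have wK: "y + (u $ i - l $ i) *\<^sub>R axis i 1 \<in> K" using yw by (simp add: w_def)
      have "f x = f y + r * (f w - f y)" if "f \<in> Q1_on K" for f
        using Q1_on_affine[OF that yw(1) wK, of r] x xr unfolding w_def by metis
      from this[OF p(1)] this[OF p(2)] * show "p x = q x" by simp
    qed
  qed
  from this[of UNIV] x show ?thesis by simp
qed

text \<open>Along an edge each component is affine, so its one-sided derivative at the vertex is
  exactly the difference quotient over the edge.\<close>

lemma grad_at_vertex:
  assumes K: "nondegenerate_box K" and v: "\<And>j. (\<lambda>x. v x $ j) \<in> Q1_on K" and z: "z \<in> vertices K"
  shows "grad v K z $ j $ i =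
    (v (opposite K i z) $ j - v z $ j) / (opposite K i z $ i - z $ i)"
proof -
  define D where "D = frechet_derivative v (at z within K)"
  define \<delta> where "\<delta> = opposite K i z $ i - z $ i"
  \<comment> \<open>The edge from \<open>z\<close> to its opposite vertex, run through for
    \<open>s\<close> in [0,1]. It stays in \<open>K\<close>, so the derivative within
    \<open>K\<close> can be composed with it.\<close>
  define \<gamma> where "\<gamma> = (\<lambda>s::real. z + (s * \<delta>) *\<^sub>R axis i 1)"
  have \<delta>: "\<delta> \<noteq> 0" using opposite_diff_sq[OF z, of i] width_pos[OF K, of i] by (auto simp: \<delta>_def)
  have zK: "z \<in> K" "opposite K i z \<in> K"
    using vertices_subset[OF K] z opposite_vertices[OF z] by auto
  have \<gamma>K: "\<gamma> s \<in> K" if "s \<in> {0..1}" for s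
  proof -
    have "convex K" using K by (auto simp: nondegenerate_box_def)
    then have "(1 - s) *\<^sub>R z + s *\<^sub>R opposite K i z \<in> K" using zK that by (auto simp: convex_alt)
    also have "(1 - s) *\<^sub>R z + s *\<^sub>R opposite K i z = \<gamma> s"
      by (subst opposite_eq) (simp add: \<gamma>_def \<delta>_def algebra_simps)
    finally show ?thesis .
  qed
  have "v differentiable (at z within K)"
    using Q1_on_differentiable[OF v zK(1)] by (subst differentiable_componentwise_within)
      (auto simp: Basis_vec_def inner_axis)
  then have D: "(v has_derivative D) (at z within K)"
    unfolding D_def by (simp add: frechet_derivative_works)
  have \<gamma>': "(\<gamma> has_derivative (\<lambda>s. (s * \<delta>) *\<^sub>R axis i 1)) (at 0 within {0..1})"
    unfolding \<gamma>_def by (auto intro!: derivative_eq_intros)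
  have "(v has_derivative D) (at (\<gamma> 0) within \<gamma> ` {0..1})"
    by (rule has_derivative_subset[of _ _ _ K]) (use D \<gamma>K in \<open>auto simp: \<gamma>_def\<close>)
  from has_derivative_in_compose[OF \<gamma>' this]
  have "((\<lambda>s. v (\<gamma> s)) has_derivative (\<lambda>s. D ((s * \<delta>) *\<^sub>R axis i 1))) (at 0 within {0..1})" .
  from bounded_linear.has_derivative[OF bounded_linear_vec_nth[of j] this]
  have 1: "((\<lambda>s. v (\<gamma> s) $ j) has_derivative (\<lambda>s. D ((s * \<delta>) *\<^sub>R axis i 1) $ j)) (at 0 within {0..1})" .
  have lin: "D ((s * \<delta>) *\<^sub>R axis i 1) $ j = s * (\<delta> * D (axis i 1) $ j)" for s
    using linear_scale[OF has_derivative_linear[OF D]] by simp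
  have vj: "v (\<gamma> s) $ j = v z $ j + s * (v (opposite K i z) $ j - v z $ j)" if "s \<in> {0..1}" for s
    using Q1_on_affine[OF v zK(1), of \<delta> i s j] zK \<gamma>K[OF that]
    unfolding \<delta>_def opposite_eq[symmetric] \<gamma>_def by auto
  have "((\<lambda>s. v z $ j + s * (v (opposite K i z) $ j - v z $ j)) has_derivative
      (\<lambda>s. s * (v (opposite K i z) $ j - v z $ j))) (at 0 within {0..1})"
    by (auto intro!: derivative_eq_intros)
  then have 2: "((\<lambda>s. v (\<gamma> s) $ j) has_derivative
      (\<lambda>s. s * (v (opposite K i z) $ j - v z $ j))) (at 0 within {0..1})"
    by (rule has_derivative_transform[rotated 2]) (use vj in auto)
  \<comment> \<open>The chain rule and the affine formula give two derivatives of one function at 0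
    within [0,1]; they coincide, uniqueness holding at an end point too.\<close>
  have "\<delta> * D (axis i 1) $ j = v (opposite K i z) $ j - v z $ j"
    using vector_derivative_unique_within_closed_interval[of 0 1 0 "\<lambda>s. v (\<gamma> s) $ j"] 1 2
    unfolding lin has_vector_derivative_def by auto
  then show ?thesis
    using \<delta> by (simp add: grad_def jacobian_def matrix_def D_def[symmetric] \<delta>_def field_simps)
qed

section \<open>Piecewise multilinear functions in \<open>H\<^sup>1\<close>\<close>

text \<open>Extended across \<open>K\<close> in direction \<open>i\<close>, the segment has length
  \<open>width K i\<close>, and the values at its ends differ by at most
  \<open>2 * B\<close>.\<close>

lemma Q1_on_slope_le:
  assumes K: "nondegenerate_box K" and p: "p \<in> Q1_on K" and B: "\<And>x. x \<in> K \<Longrightarrow> \<bar>p x\<bar> \<le> B"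
    and r: "x + r *\<^sub>R axis i 1 \<in> K" and r': "x + r' *\<^sub>R axis i 1 \<in> K"
  shows "\<bar>p (x + r *\<^sub>R axis i 1) - p (x + r' *\<^sub>R axis i 1)\<bar> \<le> 2 * B / width K i * \<bar>r - r'\<bar>"
proof -
  obtain l u where lu: "K = cbox l u" "\<And>i. l $ i < u $ i" "\<And>i. width K i = u $ i - l $ i"
    by (rule nondegenerate_boxE[OF K], rule that, assumption+)
  obtain c d where cd: "\<And>s. x + s *\<^sub>R axis i 1 \<in> K \<Longrightarrow> p (x + s *\<^sub>R axis i 1) = d + s * c"
    using Q1_on_line[OF p] by blast
  \<comment> \<open>The point of the line through \<open>x\<close> whose i-th coordinate is
    \<open>t\<close>.\<close>
  define y where "y t = x + (t - x $ i) *\<^sub>R axis i 1" for t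
  have y: "y t \<in> K" if "t \<in> {l $ i, u $ i}" for t
    using r that less_imp_le[OF lu(2)]
    by (auto simp: y_def lu(1) mem_box_cart axis_def split: if_splits)
  have "(u $ i - l $ i) * c = p (y (u $ i)) - p (y (l $ i))"
    unfolding y_def by (subst (1 2) cd) (use y in \<open>auto simp: y_def algebra_simps\<close>)
  also have "\<bar>\<dots>\<bar> \<le> 2 * B" using B[OF y[of "u $ i"]] B[OF y[of "l $ i"]] by auto
  finally have "\<bar>c\<bar> \<le> 2 * B / width K i"
    using lu(2)[of i] by (simp add: lu(3) field_simps abs_mult)
  moreover have "p (x + r *\<^sub>R axis i 1) - p (x + r' *\<^sub>R axis i 1) = c * (r - r')"
    by (simp add: cd[OF r] cd[OF r'] algebra_simps)
  ultimately show ?thesis by (metis abs_ge_zero abs_mult mult_right_mono)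
qed

text \<open>Near an interior point the backward quotients stay in \<open>K\<close>, where they equal
  the constant slope of the line.\<close>

lemma Q1_on_quotient_convergent:
  assumes p: "p \<in> Q1_on K" and x: "x \<in> interior K" and h: "h \<longlonglongrightarrow> 0" "\<And>n. h n \<noteq> 0"
  shows "convergent (\<lambda>n. (p x - p (x - h n *\<^sub>R axis i 1)) / h n)"
proof -
  obtain c d where cd: "\<And>s. x + s *\<^sub>R axis i 1 \<in> K \<Longrightarrow> p (x + s *\<^sub>R axis i 1) = d + s * c"
    using Q1_on_line[OF p] by blast
  have "(\<lambda>n. x - h n *\<^sub>R axis i 1) \<longlonglongrightarrow> x - 0 *\<^sub>R axis i 1"
    by (intro tendsto_intros h)
  then have "eventually (\<lambda>n. x - h n *\<^sub>R axis i 1 \<in> interior K) sequentially"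
    using x by (auto dest: topological_tendstoD)
  then have "eventually (\<lambda>n. (p x - p (x - h n *\<^sub>R axis i 1)) / h n = c) sequentially"
  proof eventually_elim
    case (elim n)
    then have "x + (- h n) *\<^sub>R axis i 1 \<in> K" using interior_subset by auto
    from cd[OF this] cd[of 0] x interior_subset[of K] h(2)[of n] show ?case
      by (auto simp: field_simps)
  qed
  then show ?thesis
    by (auto simp: convergent_def intro!: exI[of _ c] tendsto_eventually)
qed

section \<open>Integrability, translation and square integrability of bounded functions\<close>

lemma integrable_lborel_bounded_support:
  fixes f :: "'a::euclidean_space \<Rightarrow> real"
  assumes f: "f \<in> borel_measurable borel" and "\<And>x. \<bar>f x\<bar> \<le> B" "\<And>x. x \<notin> cbox a b \<Longrightarrow> f x = 0"
  shows "integrable lborel f"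
proof (rule Bochner_Integration.integrable_bound)
  show "integrable lborel (\<lambda>x. indicator (cbox a b) x * B)"
    by (auto simp: emeasure_lborel_cbox_eq)
  show "AE x in lborel. norm (f x) \<le> norm (indicator (cbox a b) x * B)"
  proof (rule AE_I2)
    fix x show "norm (f x) \<le> norm (indicator (cbox a b) x * B)"
      using assms(2)[of x] assms(3)[of x] by (cases "x \<in> cbox a b") auto
  qed
qed (use f in simp)

lemma AE_lborel_not_frontier_cbox: "AE x in lborel. x \<notin> cbox a b - box a (b::'a::euclidean_space)"
proof (rule AE_not_in)
  have "cbox a b - box a b \<in> null_sets (completion lborel)"
    using negligible_frontier_interval[of a b] by (simp add: negligible_iff_null_sets)
  then show "cbox a b - box a b \<in> null_sets lborel"
    by (subst (asm) null_sets_completion_iff) auto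
qed

lemma integral_lborel_translate:
  fixes f :: "'a::euclidean_space \<Rightarrow> real"
  assumes "f \<in> borel_measurable borel"
  shows "(LINT x|lborel. f (c + x)) = integral\<^sup>L lborel f"
  using integral_distr[of "(+) c" lborel borel f] assms by (simp add: lborel_distr_plus)

text \<open>Weak derivatives are stated for Lebesgue measure on the domain, while translation
  invariance is used on the whole space; this passes between the two.\<close>

lemma integral_lebesgue_on_eq_lborel:
  fixes f :: "'a::euclidean_space \<Rightarrow> real"
  assumes f: "f \<in> borel_measurable borel" and S: "S \<in> sets borel"
    and zero: "\<And>x. x \<notin> S \<Longrightarrow> f x = 0"
  shows "integral\<^sup>L (lebesgue_on S) f = integral\<^sup>L lborel f"
proof -
  have "integral\<^sup>L (lebesgue_on S) f = (LINT x|lebesgue. indicator S x *\<^sub>R f x)"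
    by (rule integral_restrict_space) (use S in auto)
  also have "(\<lambda>x. indicator S x *\<^sub>R f x) = f"
    by (rule ext) (use zero in \<open>auto simp: indicator_def\<close>)
  also have "integral\<^sup>L lebesgue f = integral\<^sup>L lborel f"
    by (rule integral_completion) (use f in simp)
  finally show ?thesis .
qed

lemma bounded_L2_space:
  fixes g :: "real^'d::finite \<Rightarrow> real"
  assumes g: "g \<in> borel_measurable borel" and bound: "AE x in lborel. x \<in> box a b \<longrightarrow> \<bar>g x\<bar> \<le> B"
  shows "g \<in> L2_space (box a b)"
proof -
  have meas: "g \<in> borel_measurable (lebesgue_on (box a b))"
    by (intro measurable_restrict_space1 measurable_completion) (use g in simp)
  interpret finite_measure "lebesgue_on (box a b)"
    by (rule finite_measure_lebesgue_on) simp
  have "integrable (lebesgue_on (box a b)) (\<lambda>x. (g x)\<^sup>2)"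
  proof (rule integrable_const_bound)
    show "AE x in lebesgue_on (box a b). norm ((g x)\<^sup>2) \<le> B\<^sup>2"
      unfolding AE_restrict_space_iff[of "box a b" lebesgue, simplified]
    proof (rule AE_completion)
      show "AE x in lborel. x \<in> box a b \<longrightarrow> norm ((g x)\<^sup>2) \<le> B\<^sup>2"
        using bound
      proof eventually_elim
        case (elim x)
        then show ?case by (auto dest: power_mono[of "\<bar>g x\<bar>" B 2])
      qed
    qed
  qed (use meas in measurable)
  with meas show ?thesis by (simp add: L2_space_def)
qed

section \<open>Test functions: bounds, support and difference quotients\<close>

locale test_function =
  fixes \<phi> :: "real^'d::finite \<Rightarrow> real" and \<Omega> :: "(real^'d) set"
  assumes test: "\<phi> \<in> test_functions \<Omega>"
begin

definition supp where "supp = closure {x. \<phi> x \<noteq> 0}"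

lemma supp: "compact supp" "supp \<subseteq> \<Omega>"
  using test by (auto simp: test_functions_def supp_def)

lemma zero: "x \<notin> supp \<Longrightarrow> \<phi> x = 0"
  using closure_subset[of "{x. \<phi> x \<noteq> 0}"] by (auto simp: supp_def)

lemma differentiable: "\<phi> differentiable (at x)"
  and partial_differentiable: "partial_deriv i \<phi> differentiable (at x)"
proof -
  have "\<forall>is. foldr partial_deriv is \<phi> differentiable_on UNIV"
    using test by (simp add: test_functions_def smooth_def)
  from spec[OF this, of "[]"] spec[OF this, of "[i]"]
  show "\<phi> differentiable (at x)" "partial_deriv i \<phi> differentiable (at x)"
    by (auto simp: differentiable_on_def)
qed

lemma continuous: "continuous_on S \<phi>" and partial_continuous: "continuous_on S (partial_deriv i \<phi>)"
  using differentiable partial_differentiable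
  by (auto intro!: continuous_at_imp_continuous_on differentiable_imp_continuous_within)

lemma measurable: "\<phi> \<in> borel_measurable borel"
  and partial_measurable: "partial_deriv i \<phi> \<in> borel_measurable borel"
  by (auto intro!: borel_measurable_continuous_onI continuous partial_continuous)

lemma partial_zero:
  assumes "x \<notin> supp"
  shows "partial_deriv i \<phi> x = 0"
proof -
  \<comment> \<open>The complement of the support is open, so the function vanishes in a
    neighbourhood of \<open>x\<close>.\<close>
  have "(\<phi> has_derivative (\<lambda>_. 0)) (at x)"
  proof (rule has_derivative_transform_within_open)
    show "((\<lambda>_. 0) has_derivative (\<lambda>_. 0)) (at x)" by simp
    show "open (- supp)" unfolding supp_def by blast
  qed (use assms zero in auto)
  from frechet_derivative_at[OF this, symmetric] show ?thesis
    by (simp add: partial_deriv_def)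
qed

lemma bounded:
  obtains M where "\<And>x. \<bar>\<phi> x\<bar> \<le> M" "\<And>x. \<bar>partial_deriv i \<phi> x\<bar> \<le> M"
proof -
  have "bounded (\<phi> ` supp)"
    by (rule compact_imp_bounded, rule compact_continuous_image, rule continuous, rule supp)
  then obtain M1 where M1: "\<And>x. x \<in> supp \<Longrightarrow> \<bar>\<phi> x\<bar> \<le> M1"
    unfolding bounded_iff by auto
  have "bounded (partial_deriv i \<phi> ` supp)"
    by (rule compact_imp_bounded, rule compact_continuous_image, rule partial_continuous, rule supp)
  then obtain M2 where M2: "\<And>x. x \<in> supp \<Longrightarrow> \<bar>partial_deriv i \<phi> x\<bar> \<le> M2"
    unfolding bounded_iff by auto
  show thesis
  proof (rule that[of "\<bar>M1\<bar> + \<bar>M2\<bar>"])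
    fix x
    show "\<bar>\<phi> x\<bar> \<le> \<bar>M1\<bar> + \<bar>M2\<bar>"
      using M1[of x] zero[of x] by (cases "x \<in> supp") auto
    show "\<bar>partial_deriv i \<phi> x\<bar> \<le> \<bar>M1\<bar> + \<bar>M2\<bar>"
      using M2[of x] partial_zero[of x i] by (cases "x \<in> supp") auto
  qed
qed

lemma line_derivative:
  "((\<lambda>s. \<phi> (x + s *\<^sub>R axis i 1)) has_field_derivative partial_deriv i \<phi> (x + s *\<^sub>R axis i 1)) (at s)"
proof -
  let ?D = "frechet_derivative \<phi> (at (x + s *\<^sub>R axis i 1))"
  have D: "(\<phi> has_derivative ?D) (at (x + s *\<^sub>R axis i 1))"
    using differentiable by (simp add: frechet_derivative_works)
  have "((\<lambda>s. x + s *\<^sub>R axis i 1) has_derivative (\<lambda>r. r *\<^sub>R axis i 1)) (at s)"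
    by (auto intro!: derivative_eq_intros)
  from has_derivative_compose[OF this D]
  have "((\<lambda>s. \<phi> (x + s *\<^sub>R axis i 1)) has_derivative (\<lambda>r. ?D (r *\<^sub>R axis i 1))) (at s)" .
  also have "(\<lambda>r. ?D (r *\<^sub>R axis i 1)) = (*) (?D (axis i 1))"
    using linear_scale[OF has_derivative_linear[OF D]] by (auto simp: mult.commute)
  finally show ?thesis
    by (simp add: has_field_derivative_def partial_deriv_def)
qed

lemma quotient_bound:
  assumes "\<And>x. \<bar>partial_deriv i \<phi> x\<bar> \<le> M" "h > 0"
  shows "\<bar>(\<phi> (x + h *\<^sub>R axis i 1) - \<phi> x) / h\<bar> \<le> M"
proof -
  obtain z where "\<phi> (x + h *\<^sub>R axis i 1) - \<phi> (x + 0 *\<^sub>R axis i 1) =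
      (h - 0) * partial_deriv i \<phi> (x + z *\<^sub>R axis i 1)"
    using MVT2[OF assms(2), of "\<lambda>s. \<phi> (x + s *\<^sub>R axis i 1)"
        "\<lambda>s. partial_deriv i \<phi> (x + s *\<^sub>R axis i 1)"] line_derivative by blast
  with assms show ?thesis by simp
qed

lemma quotient_tendsto:
  assumes "h \<longlonglongrightarrow> 0" "\<And>n. h n \<noteq> 0"
  shows "(\<lambda>n. (\<phi> (x + h n *\<^sub>R axis i 1) - \<phi> x) / h n) \<longlonglongrightarrow> partial_deriv i \<phi> x"
proof -
  have "(\<lambda>s. (\<phi> (x + s *\<^sub>R axis i 1) - \<phi> x) / s) \<midarrow>0\<rightarrow> partial_deriv i \<phi> x"
    using line_derivative[of x i 0] by (simp add: DERIV_def)
  then show ?thesis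
    using assms unfolding LIMSEQ_SEQ_conv[symmetric] by blast
qed

end

section \<open>Regularity of piecewise multilinear functions on a finite mesh of boxes\<close>

locale box_mesh =
  fixes a b :: "real^'d::finite" and \<T> :: "(real^'d) set set"
  assumes a_less_b: "a $ i < b $ i"
    and finite_mesh: "finite \<T>"
    and mesh_box: "K \<in> \<T> \<Longrightarrow> nondegenerate_box K"
    and Union_mesh: "\<Union>\<T> = cbox a b"
begin

text \<open>\<open>FE_scalar\<close> without the Sobolev condition; \<open>FE_scalar_eq\<close>
  shows that the two agree.\<close>

definition piecewise_Q1 :: "(real^'d \<Rightarrow> real) set" where
  "piecewise_Q1 = {f. (\<forall>K\<in>\<T>. f \<in> Q1_on K) \<and> (\<forall>x. x \<notin> cbox a b \<longrightarrow> f x = 0)}"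

lemma closed_mesh: "K \<in> \<T> \<Longrightarrow> closed K"
  using mesh_box by (force simp: nondegenerate_box_def)

text \<open>A single function that is polynomial on each closed element has matching values on
  common faces, so the finitely many closed pieces glue continuously.\<close>

lemma piecewise_Q1_continuous:
  assumes "f \<in> piecewise_Q1"
  shows "continuous_on (cbox a b) f"
proof -
  have "continuous_on (\<Union>K\<in>\<T>. K) f"
  proof (rule continuous_on_closed_Union)
    fix K assume "K \<in> \<T>"
    then have "f \<in> Q1_on K" using assms by (auto simp: piecewise_Q1_def)
    then show "continuous_on K f"
      by (auto simp: continuous_on_eq_continuous_within
          intro!: differentiable_imp_continuous_within Q1_on_differentiable)
  qed (auto intro: finite_mesh closed_mesh)
  then show ?thesis by (simp add: Union_mesh)
qed

lemma piecewise_Q1_bounded: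
  assumes "f \<in> piecewise_Q1"
  obtains B where "\<And>x. \<bar>f x\<bar> \<le> B"
proof -
  have "bounded (f ` cbox a b)"
    by (intro compact_imp_bounded compact_continuous_image piecewise_Q1_continuous assms) simp
  then obtain B where "\<And>x. x \<in> cbox a b \<Longrightarrow> \<bar>f x\<bar> \<le> B" by (auto simp: bounded_iff)
  moreover have "x \<notin> cbox a b \<Longrightarrow> f x = 0" for x using assms by (auto simp: piecewise_Q1_def)
  ultimately have "\<bar>f x\<bar> \<le> \<bar>B\<bar>" for x by (cases "x \<in> cbox a b") force+
  then show thesis by (rule that)
qed

lemma piecewise_Q1_measurable:
  assumes "f \<in> piecewise_Q1"
  shows "f \<in> borel_measurable borel"
proof -
  have "(\<lambda>x. indicator (cbox a b) x *\<^sub>R f x) \<in> borel_measurable borel"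
    by (intro borel_measurable_continuous_on_indicator piecewise_Q1_continuous assms) simp
  also have "(\<lambda>x. indicator (cbox a b) x *\<^sub>R f x) = f"
    by (rule ext) (use assms in \<open>auto simp: piecewise_Q1_def indicator_def\<close>)
  finally show ?thesis .
qed

text \<open>A coordinate segment is covered by the finitely many closed pieces it has in the
  elements, and a common Lipschitz constant on the pieces is one for the segment. Both ends must lie
  in the closed box, since \<open>f\<close> may jump to 0 outside.\<close>

lemma piecewise_Q1_line_lipschitz:
  assumes f: "f \<in> piecewise_Q1"
  obtains L where "L \<ge> 0"
    "\<And>x s. \<lbrakk>x \<in> cbox a b; s \<ge> 0; x - s *\<^sub>R axis i 1 \<in> cbox a b\<rbrakk>
      \<Longrightarrow> \<bar>f x - f (x - s *\<^sub>R axis i 1)\<bar> \<le> L * s"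
proof -
  obtain B where B: "\<And>x. \<bar>f x\<bar> \<le> B" using piecewise_Q1_bounded[OF f] by blast
  have B0: "B \<ge> 0" using B[of 0] by auto
  \<comment> \<open>The sum is a convenient upper bound for the slope bounds of all
    elements.\<close>
  define L where "L = (\<Sum>K\<in>\<T>. 2 * B / width K i)"
  have pos: "2 * B / width K i \<ge> 0" if "K \<in> \<T>" for K
    using B0 width_pos[OF mesh_box[OF that], of i] by simp
  have L0: "L \<ge> 0" unfolding L_def by (intro sum_nonneg pos)
  have LK: "2 * B / width K i \<le> L" if "K \<in> \<T>" for K
    unfolding L_def by (rule member_le_sum) (use that pos finite_mesh in auto)
  have "\<bar>f x - f (x - s *\<^sub>R axis i 1)\<bar> \<le> L * s"
    if x: "x \<in> cbox a b" and s: "s \<ge> 0" and xs: "x - s *\<^sub>R axis i 1 \<in> cbox a b" for x s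
  proof -
    define y where "y = x - s *\<^sub>R axis i 1"
    define U where "U K = {r. y + r *\<^sub>R axis i 1 \<in> K}" for K
    have "L-lipschitz_on {0..s} (\<lambda>r. f (y + r *\<^sub>R axis i 1))"
    proof (rule lipschitz_on_closed_Union[OF _ _ finite_mesh L0])
      fix K assume K: "K \<in> \<T>"
      show "L-lipschitz_on (U K) (\<lambda>r. f (y + r *\<^sub>R axis i 1))"
      proof (rule lipschitz_onI[OF _ L0])
        fix r r' assume r: "r \<in> U K" "r' \<in> U K"
        have "\<bar>f (y + r *\<^sub>R axis i 1) - f (y + r' *\<^sub>R axis i 1)\<bar> \<le> 2 * B / width K i * \<bar>r - r'\<bar>"
          by (rule Q1_on_slope_le[OF mesh_box[OF K]])
            (use f K B r in \<open>auto simp: piecewise_Q1_def U_def\<close>)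
        also have "\<dots> \<le> L * \<bar>r - r'\<bar>"
          by (intro mult_right_mono LK K) simp
        finally show "dist (f (y + r *\<^sub>R axis i 1)) (f (y + r' *\<^sub>R axis i 1)) \<le> L * dist r r'"
          by (simp add: dist_real_def)
      qed
      have "closed ((\<lambda>r. y + r *\<^sub>R axis i 1) -` K)"
        by (rule closed_vimage[OF closed_mesh[OF K]]) (intro continuous_intros)
      then show "closed (U K)" by (simp add: U_def vimage_def)
    next
      have "y + r *\<^sub>R axis i 1 \<in> cbox a b" if r: "r \<in> {0..s}" for r
        unfolding mem_box_cart
      proof
        fix j
        from x xs r show "a $ j \<le> (y + r *\<^sub>R axis i 1) $ j \<and> (y + r *\<^sub>R axis i 1) $ j \<le> b $ j"
          by (cases "j = i") (auto simp: y_def mem_box_cart axis_def dest!: spec[of _ j])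
      qed
      then show "{0..s} \<subseteq> (\<Union>K\<in>\<T>. U K)"
        unfolding U_def Union_mesh[symmetric] by auto
    qed
    from lipschitz_onD[OF this, of s 0] s show ?thesis
      by (simp add: y_def dist_real_def)
  qed
  with L0 show thesis by (rule that)
qed

lemma AE_interior_mesh: "AE x in lborel. x \<in> cbox a b \<longrightarrow> (\<exists>K\<in>\<T>. x \<in> interior K)"
proof -
  have "AE x in lborel. \<forall>K\<in>\<T>. x \<notin> K - interior K"
  proof (rule AE_finite_allI[OF finite_mesh])
    fix K assume "K \<in> \<T>"
    then obtain l u where "K = cbox l u" using mesh_box[of K] by (auto simp: nondegenerate_box_def)
    then show "AE x in lborel. x \<notin> K - interior K"
      using AE_lborel_not_frontier_cbox[of l u] by (simp add: interior_cbox)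
  qed
  then show ?thesis
    by eventually_elim (auto simp flip: Union_mesh)
qed

lemma piecewise_Q1_AE_quotient_convergent:
  assumes f: "f \<in> piecewise_Q1" and h: "h \<longlonglongrightarrow> 0" "\<And>n. h n \<noteq> 0"
  shows "AE x in lborel. x \<in> cbox a b \<longrightarrow> convergent (\<lambda>n. (f x - f (x - h n *\<^sub>R axis i 1)) / h n)"
  using AE_interior_mesh
  by eventually_elim
    (use f h in \<open>auto simp: piecewise_Q1_def intro!: Q1_on_quotient_convergent\<close>)

text \<open>The weak derivative is the a.e. limit of difference quotients: a translation moves the quotient
  from the test function to \<open>f\<close>, and the Lipschitz bound along coordinate lines dominates it. This
  avoids integrating by parts on the single elements.\<close>

lemma piecewise_Q1_weak_partial_deriv:
  assumes f: "f \<in> piecewise_Q1"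
  obtains g where "g \<in> L2_space (box a b)" "weak_partial_deriv (box a b) i f g"
proof -
  let ?e = "axis i 1 :: real^'d"
  define h where "h n = inverse (real (Suc n))" for n
  have h: "h \<longlonglongrightarrow> 0" "\<And>n. h n \<noteq> 0" "\<And>n. h n > 0"
    unfolding h_def by (rule LIMSEQ_inverse_real_of_nat) simp_all
  define Q where "Q n x = (f x - f (x - h n *\<^sub>R ?e)) / h n" for n x
  \<comment> \<open>Where the quotients diverge the value of \<open>lim\<close> is irrelevant: this
    happens in the box only on a null set, and \<open>g\<close> is measurable in any case.\<close>
  define g where "g x = lim (\<lambda>n. Q n x)" for x
  obtain B where B: "\<And>x. \<bar>f x\<bar> \<le> B" using piecewise_Q1_bounded[OF f] by blast
  then have B0: "B \<ge> 0" using abs_ge_zero order_trans by blast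
  obtain L where L: "L \<ge> 0" and lip: "\<And>x s. \<lbrakk>x \<in> cbox a b; s \<ge> 0; x - s *\<^sub>R ?e \<in> cbox a b\<rbrakk>
      \<Longrightarrow> \<bar>f x - f (x - s *\<^sub>R ?e)\<bar> \<le> L * s"
    using piecewise_Q1_line_lipschitz[OF f] by blast
  have f_meas [measurable]: "f \<in> borel_measurable borel" by (rule piecewise_Q1_measurable[OF f])
  have f0: "f x = 0" if "x \<notin> cbox a b" for x using f that by (auto simp: piecewise_Q1_def)
  have Q_meas [measurable]: "Q n \<in> borel_measurable borel" for n unfolding Q_def by measurable
  have g_meas [measurable]: "g \<in> borel_measurable borel" unfolding g_def by measurable
  have Q_bound: "\<bar>Q n x\<bar> \<le> L" if "x \<in> cbox a b" "x - h n *\<^sub>R ?e \<in> cbox a b" for n x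
    using lip[OF that(1) _ that(2)] h(3)[of n] by (simp add: Q_def field_simps)
  have Q_lim: "AE x in lborel. x \<in> cbox a b \<longrightarrow> (\<lambda>n. Q n x) \<longlonglongrightarrow> g x"
    using piecewise_Q1_AE_quotient_convergent[OF f h(1,2), of i]
    by eventually_elim (auto simp: g_def Q_def convergent_LIMSEQ_iff)
  have g_bound: "AE x in lborel. x \<in> box a b \<longrightarrow> \<bar>g x\<bar> \<le> L"
    using Q_lim
  proof eventually_elim
    case (elim x)
    show ?case
    proof
      assume x: "x \<in> box a b"
      have "(\<lambda>n. x - h n *\<^sub>R ?e) \<longlonglongrightarrow> x - 0 *\<^sub>R ?e" by (intro tendsto_intros h)
      then have "eventually (\<lambda>n. x - h n *\<^sub>R ?e \<in> box a b) sequentially"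
        using x by (auto dest: topological_tendstoD[OF _ open_box])
      then have "eventually (\<lambda>n. \<bar>Q n x\<bar> \<le> L) sequentially"
        by eventually_elim (use x box_subset_cbox in \<open>auto intro!: Q_bound\<close>)
      moreover have "(\<lambda>n. \<bar>Q n x\<bar>) \<longlonglongrightarrow> \<bar>g x\<bar>"
        using elim x box_subset_cbox by (intro tendsto_rabs) auto
      ultimately show "\<bar>g x\<bar> \<le> L"
        by (intro tendsto_upperbound[of "\<lambda>n. \<bar>Q n x\<bar>" _ sequentially]) auto
    qed
  qed
  have "weak_partial_deriv (box a b) i f g"
    unfolding weak_partial_deriv_def
  proof
    fix \<phi> assume "\<phi> \<in> test_functions (box a b)"
    then interpret test_function \<phi> "box a b" by unfold_locales
    note [measurable] = measurable partial_measurable[of i]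
    obtain M where M: "\<And>x. \<bar>\<phi> x\<bar> \<le> M" "\<And>x. \<bar>partial_deriv i \<phi> x\<bar> \<le> M"
      using bounded by blast
    have M0: "M \<ge> 0" using M(1)[of 0] by auto
    define P where "P n x = (\<phi> (x + h n *\<^sub>R ?e) - \<phi> x) / h n" for n x
    have P_meas [measurable]: "P n \<in> borel_measurable borel" for n unfolding P_def by measurable
    have supp_box: "supp \<subseteq> cbox a b" using supp(2) box_subset_cbox by blast
    have by_parts: "(LINT x|lborel. f x * P n x) = - (LINT x|lborel. Q n x * \<phi> x)" for n
    proof -
      \<comment> \<open>Each product is bounded and vanishes off the box through its unshifted
        factor, so the quotients may be split into separate integrals.\<close>
      have int: "integrable lborel (\<lambda>x. f x * \<phi> (x + h n *\<^sub>R ?e))"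
        "integrable lborel (\<lambda>x. f x * \<phi> x)" "integrable lborel (\<lambda>x. f (x - h n *\<^sub>R ?e) * \<phi> x)"
        by (rule integrable_lborel_bounded_support[of _ "B * M" a b];
            use f0 zero supp_box B M B0 in \<open>auto simp: abs_mult intro!: mult_mono\<close>)+
      have "(LINT x|lborel. f x * P n x) =
          ((LINT x|lborel. f x * \<phi> (x + h n *\<^sub>R ?e)) - (LINT x|lborel. f x * \<phi> x)) / h n"
        using int by (simp add: P_def right_diff_distrib flip: integral_divide_zero)
      also have "(LINT x|lborel. f x * \<phi> (x + h n *\<^sub>R ?e)) =
          (LINT x|lborel. f (x - h n *\<^sub>R ?e) * \<phi> x)"
        using integral_lborel_translate[of "\<lambda>x. f (x - h n *\<^sub>R ?e) * \<phi> x" "h n *\<^sub>R ?e"]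
        by (simp add: add.commute)
      also have "((LINT x|lborel. f (x - h n *\<^sub>R ?e) * \<phi> x) - (LINT x|lborel. f x * \<phi> x)) / h n =
          - (LINT x|lborel. Q n x * \<phi> x)"
        using int by (simp add: Q_def left_diff_distrib diff_divide_distrib)
      finally show ?thesis .
    qed
    have "(\<lambda>n. LINT x|lborel. f x * P n x) \<longlonglongrightarrow> (LINT x|lborel. f x * partial_deriv i \<phi> x)"
    proof (rule integral_dominated_convergence[where w="\<lambda>x. \<bar>f x\<bar> * M"])
      show "integrable lborel (\<lambda>x. \<bar>f x\<bar> * M)"
        by (rule integrable_lborel_bounded_support[of _ "B * M" a b])
          (use f0 B M0 in \<open>auto simp: abs_mult intro!: mult_right_mono\<close>)
      show "AE x in lborel. (\<lambda>n. f x * P n x) \<longlonglongrightarrow> f x * partial_deriv i \<phi> x"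
        unfolding P_def by (intro AE_I2 tendsto_intros quotient_tendsto h)
      show "AE x in lborel. norm (f x * P n x) \<le> \<bar>f x\<bar> * M" for n
      proof (rule AE_I2)
        fix x
        have "\<bar>P n x\<bar> \<le> M" unfolding P_def by (rule quotient_bound[OF M(2) h(3)])
        then show "norm (f x * P n x) \<le> \<bar>f x\<bar> * M" by (simp add: abs_mult mult_left_mono)
      qed
    qed simp_all
    moreover have "(\<lambda>n. LINT x|lborel. Q n x * \<phi> x) \<longlonglongrightarrow> (LINT x|lborel. g x * \<phi> x)"
    proof -
      \<comment> \<open>The support keeps a distance \<open>\<delta>\<close> from the boundary. Once
        \<open>h n < \<delta>\<close>, both points of the quotient lie in the box and
        \<open>L\<close> bounds it; for earlier \<open>n\<close> the jump of \<open>f\<close> at the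
        boundary may spoil the bound, so an initial segment is dropped.\<close>
      obtain \<delta> where \<delta>: "\<delta> > 0" "(\<Union>x\<in>supp. ball x \<delta>) \<subseteq> box a b"
        using compact_subset_open_imp_ball_epsilon_subset[OF supp(1) open_box supp(2)] by blast
      obtain N where N: "\<And>n. n \<ge> N \<Longrightarrow> h n < \<delta>"
        using order_tendstoD(2)[OF h(1) \<delta>(1)] by (auto simp: eventually_sequentially)
      have "(\<lambda>n. LINT x|lborel. Q (n + N) x * \<phi> x) \<longlonglongrightarrow> (LINT x|lborel. g x * \<phi> x)"
      proof (rule integral_dominated_convergence[where w="\<lambda>x. L * \<bar>\<phi> x\<bar>"])
        show "integrable lborel (\<lambda>x. L * \<bar>\<phi> x\<bar>)"
          by (rule integrable_lborel_bounded_support[of _ "L * M" a b])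
            (use zero supp_box M L in \<open>auto simp: abs_mult intro!: mult_left_mono\<close>)
        show "AE x in lborel. (\<lambda>n. Q (n + N) x * \<phi> x) \<longlonglongrightarrow> g x * \<phi> x"
          using Q_lim
        proof eventually_elim
          case (elim x)
          show ?case
          proof (cases "x \<in> supp")
            case True
            then have "(\<lambda>n. Q n x) \<longlonglongrightarrow> g x" using elim supp_box by blast
            then show ?thesis by (intro tendsto_mult_right LIMSEQ_ignore_initial_segment)
          qed (simp add: zero)
        qed
        show "AE x in lborel. norm (Q (n + N) x * \<phi> x) \<le> L * \<bar>\<phi> x\<bar>" for n
        proof (rule AE_I2)
          fix x
          show "norm (Q (n + N) x * \<phi> x) \<le> L * \<bar>\<phi> x\<bar>"
          proof (cases "x \<in> supp")
            case True
            have "x - h (n + N) *\<^sub>R ?e \<in> ball x \<delta>"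
              using N[of "n + N"] h(3)[of "n + N"] by (simp add: dist_norm)
            then have "x - h (n + N) *\<^sub>R ?e \<in> cbox a b"
              using True \<delta>(2) box_subset_cbox by blast
            with True supp_box show ?thesis
              by (auto simp: abs_mult intro!: mult_right_mono Q_bound)
          qed (simp add: zero)
        qed
      qed simp_all
      then show ?thesis by (rule LIMSEQ_offset)
    qed
    then have "(\<lambda>n. LINT x|lborel. f x * P n x) \<longlonglongrightarrow> - (LINT x|lborel. g x * \<phi> x)"
      unfolding by_parts by (rule tendsto_minus)
    ultimately have "(LINT x|lborel. f x * partial_deriv i \<phi> x) = - (LINT x|lborel. g x * \<phi> x)"
      by (rule LIMSEQ_unique)
    moreover have "integral\<^sup>L (lebesgue_on (box a b)) (\<lambda>x. f x * partial_deriv i \<phi> x) =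
        (LINT x|lborel. f x * partial_deriv i \<phi> x)"
      by (rule integral_lebesgue_on_eq_lborel) (use supp(2) partial_zero in auto)
    moreover have "integral\<^sup>L (lebesgue_on (box a b)) (\<lambda>x. g x * \<phi> x) =
        (LINT x|lborel. g x * \<phi> x)"
      by (rule integral_lebesgue_on_eq_lborel) (use supp(2) zero in auto)
    ultimately show "(LINT x|lebesgue_on (box a b). f x * partial_deriv i \<phi> x) =
        - (LINT x|lebesgue_on (box a b). g x * \<phi> x)"
      by simp
  qed
  with bounded_L2_space[OF g_meas g_bound] show thesis by (rule that)
qed

text \<open>The weak derivatives just constructed settle membership in \<open>H1_space\<close>; from
  here on the finite element space is handled through nodal values.\<close>

lemma FE_scalar_eq: "FE_scalar (box a b) \<T> = piecewise_Q1"
proof -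
  have "box a b \<noteq> {}" using a_less_b by (auto simp: interval_ne_empty_cart)
  then have cl: "closure (box a b) = cbox a b" by (rule closure_box)
  have "f \<in> H1_space (box a b)" if f: "f \<in> piecewise_Q1" for f
  proof -
    obtain B where "\<And>x. \<bar>f x\<bar> \<le> B" using piecewise_Q1_bounded[OF f] by blast
    then have "f \<in> L2_space (box a b)"
      by (intro bounded_L2_space piecewise_Q1_measurable f) auto
    then show ?thesis
      unfolding H1_space_def using piecewise_Q1_weak_partial_deriv[OF f] by blast
  qed
  then show ?thesis
    by (auto simp: FE_scalar_def cl piecewise_Q1_def)
qed

end

section \<open>Nodal bases on tensor product meshes\<close>

text \<open>At the first node \<open>k = 0\<close> the left slope is \<open>x / 0 = 0\<close>, which gives the correct value \<open>1\<close> there; at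
  the last node the second branch is only reached outside of the partitioned interval.\<close>

definition hat :: "(nat \<Rightarrow> real) \<Rightarrow> nat \<Rightarrow> real \<Rightarrow> real" where
  "hat t k x =
     (if x \<le> t k then max 0 (1 - (t k - x) / (t k - t (k - 1)))
      else max 0 (1 - (x - t k) / (t (Suc k) - t k)))"

lemma partition_less:
  assumes "is_partition \<alpha> \<beta> n t" "j < k" "k \<le> n"
  shows "t j < t k"
  using assms(2,3)
proof (induction k)
  case (Suc k)
  then have "t k < t (Suc k)" using assms(1) by (auto simp: is_partition_def)
  moreover have "j = k \<or> t j < t k" using Suc by (cases "j = k") auto
  ultimately show ?case by auto
qed simp

lemma partition_le: "is_partition \<alpha> \<beta> n t \<Longrightarrow> j \<le> k \<Longrightarrow> k \<le> n \<Longrightarrow> t j \<le> t k"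
  using partition_less[of \<alpha> \<beta> n t j k] by (cases "j = k") auto

lemma partition_cover:
  assumes t: "is_partition \<alpha> \<beta> n t" and "\<alpha> < \<beta>" and x: "\<alpha> \<le> x" "x \<le> \<beta>"
  obtains j where "j < n" "t j \<le> x" "x \<le> t (Suc j)"
proof -
  have "\<exists>j<k. t j \<le> x \<and> x \<le> t (Suc j)" if "k > 0" "x \<le> t k" for k
    using that
  proof (induction k)
    case (Suc k)
    show ?case
    proof (cases "k > 0 \<and> x \<le> t k")
      case True
      with Suc.IH show ?thesis by (meson less_SucI)
    next
      case False
      \<comment> \<open>For \<open>k = 0\<close> this is the lower bound on \<open>x\<close>,
        because \<open>t 0\<close> is the left end; the last subinterval then contains
        \<open>x\<close>.\<close>
      then have "t k \<le> x" using x(1) t by (cases k) (auto simp: is_partition_def)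
      with Suc.prems show ?thesis by auto
    qed
  qed simp
  moreover have "n > 0" "x \<le> t n" using t assms(2) x by (auto simp: is_partition_def intro: Suc_lessI gr0I)
  ultimately show thesis using that by blast
qed

lemma hat_node:
  assumes t: "is_partition \<alpha> \<beta> n t" and "j \<le> n" "k \<le> n"
  shows "hat t k (t j) = of_bool (j = k)"
proof -
  consider "j = k" | "j < k" | "k < j" by linarith
  then show ?thesis
  proof cases
    case 2
    then have "t j < t k" "t (k - 1) < t k" "t j \<le> t (k - 1)"
      using assms by (auto intro: partition_less[OF t] partition_le[OF t])
    then show ?thesis using 2 by (simp add: hat_def field_simps)
  next
    case 3
    then have "t k < t j" "t k < t (Suc k)" "t (Suc k) \<le> t j"
      using assms by (auto intro: partition_less[OF t] partition_le[OF t])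
    then show ?thesis using 3 by (simp add: hat_def field_simps)
  qed (simp add: hat_def)
qed

text \<open>The kinks of a hat are at nodes. The cases place the subinterval directly right of the
  peak, further right, directly left, and further left.\<close>

lemma hat_affine:
  assumes t: "is_partition \<alpha> \<beta> n t" and l: "l < n" and k: "k \<le> n"
  shows "\<exists>c d. \<forall>x\<in>{t l..t (Suc l)}. hat t k x = c * x + d"
proof -
  consider "l = k" | "k < l" | "Suc l = k" | "Suc l < k" by linarith
  then show ?thesis
  proof cases
    case 1
    have "t k < t (Suc k)" using l 1 by (intro partition_less[OF t]) auto
    then have "hat t k x = (- 1 / (t (Suc k) - t k)) * x + (1 + t k / (t (Suc k) - t k))"
      if "x \<in> {t l..t (Suc l)}" for x
    proof -
      have "hat t k x = 1 - (x - t k) / (t (Suc k) - t k)"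
        using that 1 \<open>t k < t (Suc k)\<close> by (cases "x = t k") (auto simp: hat_def)
      then show ?thesis by (simp add: diff_divide_distrib)
    qed
    then show ?thesis by blast
  next
    case 2
    then have *: "t k < t (Suc k)" "t (Suc k) \<le> t l"
      using l by (auto intro!: partition_less[OF t] partition_le[OF t])
    have "hat t k x = 0 * x + 0" if "x \<in> {t l..t (Suc l)}" for x
    proof -
      have "x > t k" "x \<ge> t (Suc k)" using that * by auto
      then show ?thesis using * by (simp add: hat_def field_simps)
    qed
    then show ?thesis by blast
  next
    case 3
    have "t l < t k" using k 3 by (intro partition_less[OF t]) auto
    moreover have "k - 1 = l" using 3 by simp
    ultimately have "hat t k x = (1 / (t k - t l)) * x + (1 - t k / (t k - t l))"
      if "x \<in> {t l..t (Suc l)}" for x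
    proof -
      have "hat t k x = 1 - (t k - x) / (t k - t l)"
        using that 3 \<open>t l < t k\<close> \<open>k - 1 = l\<close> by (auto simp: hat_def)
      then show ?thesis by (simp add: diff_divide_distrib)
    qed
    then show ?thesis by blast
  next
    case 4
    then have *: "t (k - 1) < t k" "t (Suc l) \<le> t (k - 1)"
      using k by (auto intro!: partition_less[OF t] partition_le[OF t])
    have "hat t k x = 0 * x + 0" if "x \<in> {t l..t (Suc l)}" for x
    proof -
      have "x \<le> t k" "x \<le> t (k - 1)" using that * by auto
      then show ?thesis using * by (simp add: hat_def field_simps)
    qed
    then show ?thesis by blast
  qed
qed

text \<open>The basis condition says that nodal values can be prescribed freely; it rules out
  hanging nodes, whose values are tied to those of a larger neighbour.\<close>

locale nodal_mesh = box_mesh +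
  assumes nodal_basis: "z \<in> nodes \<T> \<Longrightarrow> \<exists>\<phi>\<in>piecewise_Q1. \<forall>y\<in>nodes \<T>. \<phi> y = of_bool (y = z)"

text \<open>Basis functions are tensor products of one-dimensional hats, cut off outside the closed
  box.\<close>

lemma tensor_mesh_nodal_mesh:
  fixes a b :: "real^'d::finite"
  assumes ab: "\<And>i. a $ i < b $ i" and mesh: "tensor_mesh a b \<T>"
  shows "nodal_mesh a b \<T>"
proof -
  obtain N t where t: "\<And>i. is_partition (a $ i) (b $ i) (N i) (t i)"
    and \<T>: "\<T> = {cbox (\<chi> i. t i (k i)) (\<chi> i. t i (Suc (k i))) | k. \<forall>i. k i < N i}"
    using mesh by (auto simp: tensor_mesh_def)
  define lo where "lo k = (\<chi> i. t i (k i))" for k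
  define hi where "hi k = (\<chi> i. t i (Suc (k i)))" for k
  have \<T>': "\<T> = (\<lambda>k. cbox (lo k) (hi k)) ` PiE UNIV (\<lambda>i. {..<N i})"
    unfolding \<T> lo_def hi_def by (auto simp: PiE_iff)
  have lohi: "lo k $ i < hi k $ i" if "\<And>i. k i < N i" for k i
    using t[of i] that[of i] by (simp add: lo_def hi_def is_partition_def)
  have in_ab: "a $ i \<le> t i k \<and> t i k \<le> b $ i" if "k \<le> N i" for i k
    using partition_le[OF t, of 0 k i] partition_le[OF t, of k "N i" i] t[of i] that
    by (auto simp: is_partition_def)
  have "box_mesh a b \<T>"
  proof
    show "finite \<T>" unfolding \<T>' by (intro finite_imageI finite_PiE) auto
    show "nondegenerate_box K" if "K \<in> \<T>" for K
      using that lohi unfolding \<T>' nondegenerate_box_def by (force simp: PiE_iff)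
    show "\<Union>\<T> = cbox a b"
    proof (intro equalityI subsetI)
      fix x assume "x \<in> \<Union>\<T>"
      then obtain k where k: "\<And>i. k i < N i" "x \<in> cbox (lo k) (hi k)" unfolding \<T>' by auto
      have "a $ i \<le> x $ i \<and> x $ i \<le> b $ i" for i
        using k(1)[of i] k(2) in_ab[of "k i" i] in_ab[of "Suc (k i)" i]
        by (fastforce simp: mem_box_cart lo_def hi_def dest: spec[of _ i])
      then show "x \<in> cbox a b" by (simp add: mem_box_cart)
    next
      fix x assume x: "x \<in> cbox a b"
      have "\<exists>j<N i. t i j \<le> x $ i \<and> x $ i \<le> t i (Suc j)" for i
        by (rule partition_cover[OF t[of i] ab[of i], of "x $ i"]) (use x in \<open>auto simp: mem_box_cart\<close>)
      then obtain k where "\<And>i. k i < N i \<and> t i (k i) \<le> x $ i \<and> x $ i \<le> t i (Suc (k i))" by metis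
      then have "k \<in> PiE UNIV (\<lambda>i. {..<N i})" "x \<in> cbox (lo k) (hi k)"
        by (auto simp: mem_box_cart lo_def hi_def)
      then show "x \<in> \<Union>\<T>" unfolding \<T>' by blast
    qed
  qed (rule ab)
  then interpret box_mesh a b \<T> .
  \<comment> \<open>Elements have indices below \<open>N i\<close>, but upper corners use the
    successor, so node indices reach \<open>N i\<close> itself.\<close>
  have node: "\<exists>k. \<forall>i. k i \<le> N i \<and> z $ i = t i (k i)" if "z \<in> nodes \<T>" for z
  proof -
    obtain k where k: "\<And>i. k i < N i" and z: "z \<in> vertices (cbox (lo k) (hi k))"
      using \<open>z \<in> nodes \<T>\<close> unfolding nodes_def \<T>' by auto
    have "\<exists>j. j \<le> N i \<and> z $ i = t i j" for i
    proof -
      have "z $ i = lo k $ i \<or> z $ i = hi k $ i"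
        using z lohi[OF k] by (simp add: vertices_def interval_bounds_cart less_imp_le)
      then show ?thesis using k[of i] by (auto simp: lo_def hi_def intro: exI[of _ "k i"] exI[of _ "Suc (k i)"])
    qed
    then show ?thesis by metis
  qed
  show ?thesis
  proof
    fix z assume "z \<in> nodes \<T>"
    then obtain k where k: "\<And>i. k i \<le> N i" "\<And>i. z $ i = t i (k i)" using node by metis
    define \<phi> where "\<phi> x = (if x \<in> cbox a b then \<Prod>i\<in>UNIV. hat (t i) (k i) (x $ i) else 0)" for x
    show "\<exists>\<phi>\<in>piecewise_Q1. \<forall>y\<in>nodes \<T>. \<phi> y = of_bool (y = z)"
    proof (intro bexI ballI)
      fix y assume "y \<in> nodes \<T>"
      then obtain l where l: "\<And>i. l i \<le> N i" "\<And>i. y $ i = t i (l i)" using node by metis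
      have y: "y \<in> cbox a b" using in_ab[OF l(1)] by (simp add: mem_box_cart l(2))
      have h: "hat (t i) (k i) (y $ i) = of_bool (l i = k i)" for i
        unfolding l(2) by (rule hat_node[OF t l(1) k(1)])
      show "\<phi> y = of_bool (y = z)"
      proof (cases "y = z")
        case True
        \<comment> \<open>A partition is strictly increasing, so a coordinate determines its
          index.\<close>
        have "l i = k i" for i
          using partition_less[OF t, of "l i" "k i" i] partition_less[OF t, of "k i" "l i" i]
            k[of i] l[of i] True by (metis less_irrefl linorder_neqE_nat)
        with y h True show ?thesis by (simp add: \<phi>_def prod.neutral)
      next
        case False
        then obtain i where "l i \<noteq> k i" using k(2) l(2) by (metis vec_eq_iff)
        then have "(\<Prod>i\<in>UNIV. hat (t i) (k i) (y $ i)) = 0"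
          by (intro prod_zero) (auto simp: h)
        with False y show ?thesis by (simp add: \<phi>_def)
      qed
    next
      have "\<phi> \<in> Q1_on K" if "K \<in> \<T>" for K
      proof -
        obtain l where l: "\<And>i. l i < N i" "K = cbox (lo l) (hi l)"
          using \<open>K \<in> \<T>\<close> unfolding \<T>' by auto
        have "\<exists>c d. \<forall>x\<in>{t i (l i)..t i (Suc (l i))}. hat (t i) (k i) x = c * x + d" for i
          by (rule hat_affine[OF t l(1) k(1)])
        then obtain c d where cd: "\<And>i x. x \<in> {t i (l i)..t i (Suc (l i))} \<Longrightarrow>
            hat (t i) (k i) x = c i * x + d i" by metis
        show ?thesis
        proof (rule Q1_on_cong[OF Q1_on_prod_affine])
          fix x assume x: "x \<in> K"
          then have "x \<in> cbox a b" using that Union_mesh by blast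
          then have "\<phi> x = (\<Prod>i\<in>UNIV. hat (t i) (k i) (x $ i))" by (simp add: \<phi>_def)
          also have "\<dots> = (\<Prod>i\<in>UNIV. c i * x $ i + d i)"
            by (intro prod.cong cd refl) (use x in \<open>auto simp: l(2) mem_box_cart lo_def hi_def\<close>)
          finally show "\<phi> x = (\<Prod>i\<in>UNIV. c i * x $ i + d i)" .
        qed
      qed
      then show "\<phi> \<in> piecewise_Q1" by (simp add: piecewise_Q1_def \<phi>_def)
    qed
  qed
qed

section \<open>Interpolation, quadrature and the discrete Laplacian\<close>

context nodal_mesh
begin

lemma finite_nodes: "finite (nodes \<T>)"
  by (simp add: nodes_def finite_mesh finite_vertices)

lemma vertices_nodes: "K \<in> \<T> \<Longrightarrow> vertices K \<subseteq> nodes \<T>"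
  by (auto simp: nodes_def)

lemma piecewise_Q1_eq_nodes:
  assumes p: "p \<in> piecewise_Q1" "q \<in> piecewise_Q1" and eq: "\<And>z. z \<in> nodes \<T> \<Longrightarrow> p z = q z"
  shows "p = q"
proof
  fix x
  show "p x = q x"
  proof (cases "x \<in> cbox a b")
    case True
    then obtain K where K: "K \<in> \<T>" "x \<in> K" using Union_mesh by blast
    then have "p \<in> Q1_on K" "q \<in> Q1_on K" using p by (auto simp: piecewise_Q1_def)
    then show ?thesis
      using Q1_on_eq_vertices[OF mesh_box[OF K(1)], of p q x] K vertices_nodes[OF K(1)] eq by blast
  next
    case False
    with p show ?thesis by (simp add: piecewise_Q1_def)
  qed
qed

lemma piecewise_Q1_sum:
  "(\<And>z. z \<in> S \<Longrightarrow> p z \<in> piecewise_Q1) \<Longrightarrow> (\<lambda>x. \<Sum>z\<in>S. c z * p z x) \<in> piecewise_Q1"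
  unfolding piecewise_Q1_def by (auto intro!: Q1_on_sum Q1_on_cmult sum.neutral)

lemma piecewise_Q1_diff:
  assumes "p \<in> piecewise_Q1" "q \<in> piecewise_Q1"
  shows "(\<lambda>x. p x - q x) \<in> piecewise_Q1"
proof -
  have "(\<lambda>x. p x + (- 1) * q x) \<in> Q1_on K" if "K \<in> \<T>" for K
    using assms that by (intro Q1_on_add Q1_on_cmult) (auto simp: piecewise_Q1_def)
  then show ?thesis using assms by (simp add: piecewise_Q1_def)
qed

text \<open>The definite description is justified by the nodal basis for existence and by
  \<open>piecewise_Q1_eq_nodes\<close> for uniqueness.\<close>

lemma interp_scalar:
  "interp_scalar (box a b) \<T> f \<in> piecewise_Q1 \<and>
    (\<forall>z\<in>nodes \<T>. interp_scalar (box a b) \<T> f z = f z)"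
proof -
  obtain \<phi> where \<phi>: "\<And>z. z \<in> nodes \<T> \<Longrightarrow> \<phi> z \<in> piecewise_Q1"
    "\<And>y z. y \<in> nodes \<T> \<Longrightarrow> z \<in> nodes \<T> \<Longrightarrow> \<phi> z y = of_bool (y = z)"
    using nodal_basis by metis
  define p where "p x = (\<Sum>z\<in>nodes \<T>. f z * \<phi> z x)" for x
  have p: "p \<in> piecewise_Q1" unfolding p_def by (rule piecewise_Q1_sum) (rule \<phi>)
  have pf: "p y = f y" if "y \<in> nodes \<T>" for y
  proof -
    have "p y = (\<Sum>z\<in>nodes \<T>. if y = z then f z else 0)"
      unfolding p_def by (intro sum.cong) (auto simp: \<phi>(2) that)
    then show ?thesis using that finite_nodes by simp
  qed
  show ?thesis
    unfolding interp_scalar_def FE_scalar_eq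
    by (rule theI[where a=p]) (use p pf in \<open>auto intro: piecewise_Q1_eq_nodes\<close>)
qed

lemma FE_space_eq: "FE_space (box a b) \<T> = {v. \<forall>j. (\<lambda>x. v x $ j) \<in> piecewise_Q1}"
  by (simp add: FE_space_def FE_scalar_eq)

lemma FE_space_eq_nodes:
  assumes "v \<in> FE_space (box a b) \<T>" "w \<in> FE_space (box a b) \<T>"
    "\<And>z. z \<in> nodes \<T> \<Longrightarrow> v z = w z"
  shows "v = w"
proof -
  have "(\<lambda>x. v x $ j) = (\<lambda>x. w x $ j)" for j
    by (rule piecewise_Q1_eq_nodes) (use assms in \<open>auto simp: FE_space_eq\<close>)
  then show ?thesis by (metis (no_types) ext vec_eq_iff)
qed

lemma FE_space_diff:
  "v \<in> FE_space (box a b) \<T> \<Longrightarrow> w \<in> FE_space (box a b) \<T> \<Longrightarrow>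
    (\<lambda>x. v x - w x) \<in> FE_space (box a b) \<T>"
  by (simp add: FE_space_eq piecewise_Q1_diff)

lemma interp_FE_space: "interp (box a b) \<T> f \<in> FE_space (box a b) \<T>"
  using interp_scalar by (simp add: FE_space_eq interp_def)

lemma interp_node: "z \<in> nodes \<T> \<Longrightarrow> interp (box a b) \<T> f z = f z"
  using interp_scalar by (simp add: interp_def vec_eq_iff)

section \<open>The discrete Dirichlet form as a sum over edges\<close>

definition weight :: "(real^'a) set \<Rightarrow> real" where
  "weight K = measure lborel K / 2 ^ CARD('a)"

lemma weight_pos: "K \<in> \<T> \<Longrightarrow> weight K > 0"
  by (simp add: weight_def measure_pos mesh_box)

lemma grad_FE:
  assumes "v \<in> FE_space (box a b) \<T>" "K \<in> \<T>" "z \<in> vertices K"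
  shows "grad v K z $ j $ i = (v (opposite K i z) $ j - v z $ j) / (opposite K i z $ i - z $ i)"
  by (rule grad_at_vertex) (use assms mesh_box in \<open>auto simp: FE_space_eq piecewise_Q1_def\<close>)

text \<open>Both gradients carry the same signed edge length in the denominator, so the product
  contains only the squared width.\<close>

lemma grad_inner:
  assumes v: "v \<in> FE_space (box a b) \<T>" and w: "w \<in> FE_space (box a b) \<T>"
    and K: "K \<in> \<T>" and z: "z \<in> vertices K"
  shows "grad v K z \<bullet> grad w K z =
    (\<Sum>i\<in>UNIV. (v (opposite K i z) - v z) \<bullet> (w (opposite K i z) - w z) / (width K i)\<^sup>2)"
proof -
  have "grad v K z \<bullet> grad w K z = (\<Sum>j\<in>UNIV. \<Sum>i\<in>UNIV. grad v K z $ j $ i * grad w K z $ j $ i)"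
    by (simp add: inner_vec_def)
  also have "\<dots> = (\<Sum>i\<in>UNIV. \<Sum>j\<in>UNIV. grad v K z $ j $ i * grad w K z $ j $ i)"
    by (rule sum.swap)
  also have "\<dots> = (\<Sum>i\<in>UNIV. (v (opposite K i z) - v z) \<bullet> (w (opposite K i z) - w z) / (width K i)\<^sup>2)"
    by (intro sum.cong refl)
      (simp add: grad_FE[OF v K z] grad_FE[OF w K z] inner_vec_def sum_divide_distrib
        power2_eq_square[symmetric] opposite_diff_sq[OF z])
  finally show ?thesis .
qed

text \<open>The contribution of one element to the finite difference Laplacian at a vertex. The
  factor 2 arises because the quadrature visits every edge of \<open>K\<close> from both
  ends.\<close>

definition edge_laplacian :: "(real^'a) set \<Rightarrow> (real^'a \<Rightarrow> real^3) \<Rightarrow> real^'a \<Rightarrow> real^3" where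
  "edge_laplacian K v z = (\<Sum>i\<in>UNIV. (2 / (width K i)\<^sup>2) *\<^sub>R (v (opposite K i z) - v z))"

text \<open>Reindexing by \<open>opposite\<close> flips the sign of the edge difference, so the
  terms with \<open>w\<close> at the far end equal minus those with \<open>w\<close> at the near
  end.\<close>

lemma sum_edges_by_parts:
  fixes v w :: "real^'a \<Rightarrow> real^3"
  shows "(\<Sum>z\<in>vertices K. (v (opposite K i z) - v z) \<bullet> (w (opposite K i z) - w z)) =
    - 2 * (\<Sum>z\<in>vertices K. (v (opposite K i z) - v z) \<bullet> w z)"
proof -
  have "(\<Sum>z\<in>vertices K. (v (opposite K i z) - v z) \<bullet> w (opposite K i z)) =
      (\<Sum>z\<in>vertices K. (v z - v (opposite K i z)) \<bullet> w z)"
    using sum_vertices_opposite[of "\<lambda>z. (v z - v (opposite K i z)) \<bullet> w z" K i] by simp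
  then show ?thesis
    by (simp add: inner_diff_left inner_diff_right sum_subtractf)
qed

lemma quad_grad:
  assumes v: "v \<in> FE_space (box a b) \<T>" and w: "w \<in> FE_space (box a b) \<T>"
  shows "quad_inner \<T> (grad v) (grad w) =
    - (\<Sum>K\<in>\<T>. \<Sum>z\<in>vertices K. weight K * (edge_laplacian K v z \<bullet> w z))"
proof -
  have "(\<Sum>z\<in>vertices K. weight K * (grad v K z \<bullet> grad w K z)) =
      - (\<Sum>z\<in>vertices K. weight K * (edge_laplacian K v z \<bullet> w z))" if K: "K \<in> \<T>" for K
  proof -
    have "(\<Sum>z\<in>vertices K. grad v K z \<bullet> grad w K z) = (\<Sum>i\<in>UNIV. (\<Sum>z\<in>vertices K.
        (v (opposite K i z) - v z) \<bullet> (w (opposite K i z) - w z)) / (width K i)\<^sup>2)"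
      by (simp add: grad_inner[OF v w K] sum_divide_distrib sum.swap[of _ "vertices K"])
    also have "\<dots> = - (\<Sum>i\<in>UNIV. \<Sum>z\<in>vertices K.
        2 / (width K i)\<^sup>2 * ((v (opposite K i z) - v z) \<bullet> w z))"
      unfolding sum_edges_by_parts by (simp add: sum_negf sum_distrib_left sum_divide_distrib)
    also have "\<dots> = - (\<Sum>z\<in>vertices K. edge_laplacian K v z \<bullet> w z)"
      by (simp add: edge_laplacian_def inner_sum_left sum.swap[of _ "vertices K"])
    finally show ?thesis by (simp flip: sum_distrib_left)
  qed
  then show ?thesis by (simp add: quad_inner_def weight_def sum_negf)
qed

section \<open>Mass lumping and well-posedness of the discrete Laplacian\<close>

definition node_weight :: "real^'a \<Rightarrow> real" where
  "node_weight z = (\<Sum>K | K \<in> \<T> \<and> z \<in> vertices K. weight K)"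

lemma node_weight_pos:
  assumes "z \<in> nodes \<T>"
  shows "node_weight z > 0"
proof -
  have "{K. K \<in> \<T> \<and> z \<in> vertices K} \<noteq> {}" using assms by (auto simp: nodes_def)
  then show ?thesis
    unfolding node_weight_def by (intro sum_pos) (auto simp: finite_mesh weight_pos)
qed

lemma sum_vertices_nodes:
  "(\<Sum>K\<in>\<T>. \<Sum>z\<in>vertices K. G K z) = (\<Sum>z\<in>nodes \<T>. \<Sum>K | K \<in> \<T> \<and> z \<in> vertices K. G K z)"
proof -
  have "(\<Sum>K\<in>\<T>. \<Sum>z\<in>vertices K. G K z) = (\<Sum>K\<in>\<T>. \<Sum>z | z \<in> nodes \<T> \<and> z \<in> vertices K. G K z)"
    by (intro sum.cong) (auto dest: vertices_nodes)
  also have "\<dots> = (\<Sum>z\<in>nodes \<T>. \<Sum>K | K \<in> \<T> \<and> z \<in> vertices K. G K z)"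
    by (rule sum.swap_restrict) (rule finite_mesh finite_nodes)+
  finally show ?thesis .
qed

text \<open>Collecting the elements around each node shows that the lumped mass matrix is diagonal,
  with entries \<open>node_weight\<close>.\<close>

lemma quad_inner_nodes:
  "quad_inner \<T> (\<lambda>_. u) (\<lambda>_. w) = (\<Sum>z\<in>nodes \<T>. node_weight z * (u z \<bullet> w z))"
  by (simp add: quad_inner_def sum_vertices_nodes node_weight_def sum_distrib_right flip: weight_def)

lemma quad_inner_nodes_definite:
  assumes "quad_inner \<T> (\<lambda>_. u) (\<lambda>_. u) = 0" "z \<in> nodes \<T>"
  shows "u z = 0"
proof -
  have "node_weight z * (u z \<bullet> u z) = 0"
    using assms node_weight_pos unfolding quad_inner_nodes
    by (subst (asm) sum_nonneg_eq_0_iff) (auto simp: finite_nodes less_imp_le)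
  then show ?thesis using node_weight_pos[OF assms(2)] by simp
qed

text \<open>Existence comes from inverting the diagonal mass matrix, uniqueness from testing the
  difference of two solutions with itself.\<close>

lemma discrete_laplacian:
  assumes v: "v \<in> FE_space (box a b) \<T>"
  shows "discrete_laplacian (box a b) \<T> v \<in> FE_space (box a b) \<T> \<and>
    (\<forall>w\<in>FE_space (box a b) \<T>.
      quad_inner \<T> (\<lambda>_. discrete_laplacian (box a b) \<T> v) (\<lambda>_. w) = - quad_inner \<T> (grad v) (grad w))"
proof -
  \<comment> \<open>The nodal values forced by summation by parts: assembled edge Laplacians divided
    by the lumped mass.\<close>
  define f where "f z =
    inverse (node_weight z) *\<^sub>R (\<Sum>K | K \<in> \<T> \<and> z \<in> vertices K. weight K *\<^sub>R edge_laplacian K v z)" for z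
  define u where "u = interp (box a b) \<T> f"
  have u: "u \<in> FE_space (box a b) \<T>" unfolding u_def by (rule interp_FE_space)
  have quad: "quad_inner \<T> (\<lambda>_. u) (\<lambda>_. w) = - quad_inner \<T> (grad v) (grad w)"
    if w: "w \<in> FE_space (box a b) \<T>" for w
  proof -
    have "node_weight z * (u z \<bullet> w z) =
        (\<Sum>K | K \<in> \<T> \<and> z \<in> vertices K. weight K * (edge_laplacian K v z \<bullet> w z))"
      if "z \<in> nodes \<T>" for z
      using node_weight_pos[OF that] by (simp add: u_def interp_node that f_def inner_sum_left)
    then show ?thesis
      unfolding quad_inner_nodes quad_grad[OF v w] sum_vertices_nodes by simp
  qed
  show ?thesis
    unfolding discrete_laplacian_def
  proof (rule theI[where a=u])
    fix u' assume u': "u' \<in> FE_space (box a b) \<T> \<and> (\<forall>w\<in>FE_space (box a b) \<T>.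
        quad_inner \<T> (\<lambda>_. u') (\<lambda>_. w) = - quad_inner \<T> (grad v) (grad w))"
    define d where "d x = u' x - u x" for x
    have "d \<in> FE_space (box a b) \<T>" unfolding d_def using u u' by (intro FE_space_diff) auto
    then have "quad_inner \<T> (\<lambda>_. u') (\<lambda>_. d) = quad_inner \<T> (\<lambda>_. u) (\<lambda>_. d)"
      using u' quad by simp
    then have "quad_inner \<T> (\<lambda>_. d) (\<lambda>_. d) = 0"
      by (simp add: quad_inner_nodes d_def inner_diff_left right_diff_distrib sum_subtractf)
    then have "u' z = u z" if "z \<in> nodes \<T>" for z
      using quad_inner_nodes_definite[where u=d, OF _ that] by (simp add: d_def)
    with u u' show "u' = u" by (blast intro: FE_space_eq_nodes)
  qed (use u quad in blast)
qed

text \<open>The factor \<open>(m \<bullet> v) *\<^sub>R m\<close> need not be a finite element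
  function, but the lumped product sees only its nodal values. Its interpolant \<open>I\<close> has
  the same ones and is an admissible test function for the discrete Laplacian.\<close>

lemma quad_cross_laplacian:
  assumes m: "m \<in> FE_space (box a b) \<T>" and unit: "\<forall>z\<in>nodes \<T>. norm (m z) = 1"
    and v: "v \<in> FE_space (box a b) \<T>" and w: "w \<in> FE_space (box a b) \<T>"
  shows "quad_inner \<T> (\<lambda>_ x. cross3 (m x) (cross3 (m x) (discrete_laplacian (box a b) \<T> w x))) (\<lambda>_. v)
    = quad_inner \<T> (grad w) (grad v)
      - quad_inner \<T> (grad w) (grad (interp (box a b) \<T> (\<lambda>x. (m x \<bullet> v x) *\<^sub>R m x)))"
proof -
  define u where "u = discrete_laplacian (box a b) \<T> w"
  define I where "I = interp (box a b) \<T> (\<lambda>x. (m x \<bullet> v x) *\<^sub>R m x)"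
  have I: "I \<in> FE_space (box a b) \<T>" unfolding I_def by (rule interp_FE_space)
  have "node_weight z * (cross3 (m z) (cross3 (m z) (u z)) \<bullet> v z) =
      node_weight z * (u z \<bullet> I z) - node_weight z * (u z \<bullet> v z)" if z: "z \<in> nodes \<T>" for z
  proof -
    have "m z \<bullet> m z = 1" using bspec[OF unit z] by (simp add: norm_eq_1)
    then have "cross3 (m z) (cross3 (m z) (u z)) = (m z \<bullet> u z) *\<^sub>R m z - u z"
      by (simp add: Lagrange)
    moreover have "I z = (m z \<bullet> v z) *\<^sub>R m z" unfolding I_def using z by (rule interp_node)
    ultimately show ?thesis
      by (simp add: inner_diff_left right_diff_distrib inner_commute[of "u z" "m z"] mult_ac)
  qed
  then have "quad_inner \<T> (\<lambda>_ x. cross3 (m x) (cross3 (m x) (u x))) (\<lambda>_. v) =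
      quad_inner \<T> (\<lambda>_. u) (\<lambda>_. I) - quad_inner \<T> (\<lambda>_. u) (\<lambda>_. v)"
    by (simp add: quad_inner_nodes sum_subtractf)
  also have "\<dots> = quad_inner \<T> (grad w) (grad v) - quad_inner \<T> (grad w) (grad I)"
    using discrete_laplacian[OF w] I v by (simp add: u_def)
  finally show ?thesis unfolding u_def I_def .
qed

text \<open>The discrete counterpart of \<open>\<nabla>m : \<nabla>(s m) = \<bar>\<nabla>m\<bar>\<^sup>2 s\<close>.\<close>

lemma quad_grad_unit_projection:
  assumes m: "m \<in> FE_space (box a b) \<T>" and unit: "\<forall>z\<in>nodes \<T>. norm (m z) = 1"
  shows "quad_inner \<T> (grad m) (grad (interp (box a b) \<T> (\<lambda>x. (m x \<bullet> v x) *\<^sub>R m x)))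
    = quad_inner \<T> (\<lambda>K x. (norm (grad m K x))\<^sup>2) (\<lambda>_ x. m x \<bullet> v x)"
proof -
  define I where "I = interp (box a b) \<T> (\<lambda>x. (m x \<bullet> v x) *\<^sub>R m x)"
  have I: "I \<in> FE_space (box a b) \<T>" unfolding I_def by (rule interp_FE_space)
  have "- (edge_laplacian K m z \<bullet> I z) = (norm (grad m K z))\<^sup>2 * (m z \<bullet> v z)"
    if K: "K \<in> \<T>" and z: "z \<in> vertices K" for K z
  proof -
    have zn: "z \<in> nodes \<T>" "opposite K i z \<in> nodes \<T>" for i
      using z K opposite_vertices vertices_nodes by blast+
    have Iz: "I z = (m z \<bullet> v z) *\<^sub>R m z" unfolding I_def using zn(1) by (rule interp_node)
    \<comment> \<open>With unit length at both ends, each side is 2 minus twice the inner product of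
      the end values.\<close>
    have edge: "(m (opposite K i z) - m z) \<bullet> (m (opposite K i z) - m z) =
        - 2 * ((m (opposite K i z) - m z) \<bullet> m z)" for i
      using bspec[OF unit zn(1)] bspec[OF unit zn(2)[of i]]
      by (simp add: inner_diff_left inner_diff_right norm_eq_1 inner_commute)
    have "(norm (grad m K z))\<^sup>2 = (\<Sum>i\<in>UNIV. - 2 * ((m (opposite K i z) - m z) \<bullet> m z) / (width K i)\<^sup>2)"
      unfolding power2_norm_eq_inner grad_inner[OF m m K z] edge ..
    also have "\<dots> = - (edge_laplacian K m z \<bullet> m z)"
      by (simp add: edge_laplacian_def inner_sum_left sum_negf)
    finally show ?thesis by (simp add: Iz)
  qed
  then have "(\<Sum>K\<in>\<T>. \<Sum>z\<in>vertices K. weight K * - (edge_laplacian K m z \<bullet> I z)) =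
      (\<Sum>K\<in>\<T>. \<Sum>z\<in>vertices K. weight K * ((norm (grad m K z))\<^sup>2 * (m z \<bullet> v z)))"
    by (intro sum.cong refl) simp
  then show ?thesis
    unfolding I_def[symmetric] quad_grad[OF m I]
    by (simp add: quad_inner_def weight_def sum_negf)
qed

text \<open>Linearity is read off from the edge differences, without differentiating the difference
  of the functions.\<close>

lemma quad_grad_diff_left:
  assumes "v \<in> FE_space (box a b) \<T>" "v' \<in> FE_space (box a b) \<T>" "w \<in> FE_space (box a b) \<T>"
  shows "quad_inner \<T> (grad (\<lambda>x. v x - v' x)) (grad w) =
    quad_inner \<T> (grad v) (grad w) - quad_inner \<T> (grad v') (grad w)"
proof -
  have "edge_laplacian K (\<lambda>x. v x - v' x) z = edge_laplacian K v z - edge_laplacian K v' z" for K z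
    unfolding edge_laplacian_def sum_subtractf[symmetric]
    by (intro sum.cong refl) (simp add: algebra_simps)
  then show ?thesis
    by (simp add: quad_grad assms FE_space_diff inner_diff_left right_diff_distrib sum_subtractf)
qed

end

theorem mainTheorem6:
  fixes a b :: "real^'d::finite"
    and \<Omega> :: "(real^'d) set"
    and F :: "(real^'d) set set set"
    and \<T> :: "(real^'d) set set"
    and \<Delta>t :: real
    and m m' :: "real^'d \<Rightarrow> real^3"
  assumes "CARD('d) \<in> {1, 2, 3}"
    and "\<forall>i. a $ i < b $ i" and "\<Omega> = box a b"
    and "\<forall>\<T>'\<in>F. tensor_mesh a b \<T>'" and "shape_regular F" and "quasi_uniform F"
    and "\<T> \<in> F"
    and "\<Delta>t > 0"
    and "m \<in> FE_space \<Omega> \<T>" and "\<forall>z\<in>nodes \<T>. norm (m z) = 1"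
    and "m' \<in> FE_space \<Omega> \<T>"
  shows
    "(\<forall>v\<in>FE_space \<Omega> \<T>.
        quad_inner \<T> (\<lambda>_ x. (m' x - m x) /\<^sub>R \<Delta>t) (\<lambda>_. v)
        = - quad_inner \<T> (\<lambda>_ x. cross3 (m x) (cross3 (m x) (discrete_laplacian \<Omega> \<T> m' x))) (\<lambda>_. v))
     \<longleftrightarrow>
     (\<forall>v\<in>FE_space \<Omega> \<T>.
        quad_inner \<T> (\<lambda>_ x. (m' x - m x) /\<^sub>R \<Delta>t) (\<lambda>_. v) + quad_inner \<T> (grad m') (grad v)
        = quad_inner \<T> (\<lambda>K x. (norm (grad m K x))\<^sup>2) (\<lambda>_ x. m x \<bullet> v x)
          + quad_inner \<T> (grad (\<lambda>x. m' x - m x))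
                         (grad (interp \<Omega> \<T> (\<lambda>x. (m x \<bullet> v x) *\<^sub>R m x))))"
proof -
  interpret nodal_mesh a b \<T>
    using assms by (intro tensor_mesh_nodal_mesh) auto
  note \<Omega> = \<open>\<Omega> = box a b\<close>
  have m: "m \<in> FE_space (box a b) \<T>" and m': "m' \<in> FE_space (box a b) \<T>"
    and unit: "\<forall>z\<in>nodes \<T>. norm (m z) = 1"
    using assms by auto
  show ?thesis
    unfolding \<Omega>
  proof (intro ball_cong refl)
    fix v assume v: "v \<in> FE_space (box a b) \<T>"
    show "(quad_inner \<T> (\<lambda>_ x. (m' x - m x) /\<^sub>R \<Delta>t) (\<lambda>_. v)
        = - quad_inner \<T> (\<lambda>_ x. cross3 (m x) (cross3 (m x) (discrete_laplacian (box a b) \<T> m' x))) (\<lambda>_. v))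
     \<longleftrightarrow>
       (quad_inner \<T> (\<lambda>_ x. (m' x - m x) /\<^sub>R \<Delta>t) (\<lambda>_. v) + quad_inner \<T> (grad m') (grad v)
        = quad_inner \<T> (\<lambda>K x. (norm (grad m K x))\<^sup>2) (\<lambda>_ x. m x \<bullet> v x)
          + quad_inner \<T> (grad (\<lambda>x. m' x - m x))
                         (grad (interp (box a b) \<T> (\<lambda>x. (m x \<bullet> v x) *\<^sub>R m x))))"
      \<comment> \<open>The equivalence holds for each \<open>v\<close> separately. In the second
        relation the term in \<open>m\<close> from the gradient of the difference cancels the one
        from the squared gradient, leaving the rearranged first relation.\<close>
      unfolding quad_cross_laplacian[OF m unit v m'] quad_grad_unit_projection[OF m unit, symmetric]
        quad_grad_diff_left[OF m' m interp_FE_space]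
      by linarith
  qed
qed

end
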